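(* For every $a\in(0,1)$, the left-invariant sub-Riemannian problem on $\mathrm{SO}(3)$ with orthonormal frame $X_1=A_2$, $X_2=\sqrt{1-a^2}\,A_1$ has an infinite number of periodic geodesics.
   Context: $A_1,A_2,A_3$ is the standard basis of $\mathfrak{so}(3)$: $A_1=\begin{pmatrix}0&0&0\\0&0&-1\\0&1&0\end{pmatrix}$, $A_2=\begin{pmatrix}0&0&1\\0&0&0\\-1&0&0\end{pmatrix}$, $A_3=\begin{pmatrix}0&-1&0\\1&0&0\\0&0&0\end{pmatrix}$. Sub-Riemannian problem: fix $a\in(0,1)$ and put $X_1=A_2$, $X_2=\sqrt{1-a^2}A_1$. A Lipschitz curve $R:[0,T]\to \mathrm{SO}(3)$ with $R(0)=\mathrm{Id}$ is horizontal if $\dot R=R(u_1X_1+u_2X_2)$ for almost every $t$; its length is $\int_0^T\sqrt{u_1^2+u_2^2}\,dt$ (that is, $RX_1,RX_2$ are declared orthonormal). Geodesics are horizontal curves whose short arcs are length minimizers. Parameterized by arclength and starting at $\mathrm{Id}$, the geodesics are exactly the curves $R_t$ for which there is $p_t=(p_1(t),p_2(t),p_3(t))\in\mathbb{R}^3$ with $$\dot R=R(p_1X_1+p_2X_2),\quad R_0=\mathrm{Id},\qquad \dot p_1=p_3p_2,\quad \dot p_2=-p_3p_1,\quad \dot p_3=a^2p_1p_2,\qquad p_1^2+p_2^2=1.$$ A geodesic is periodic if $R_{t+T}=R_t$ for all $t$ for some $T>0$. *)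

theory Defs
  imports "HOL-Analysis.Analysis"
begin

definition A1 :: "real^3^3" where
  "A1 = vector [vector [0, 0, 0], vector [0, 0, -1], vector [0, 1, 0]]"

definition A2 :: "real^3^3" where
  "A2 = vector [vector [0, 0, 1], vector [0, 0, 0], vector [-1, 0, 0]]"

definition X1 :: "real^3^3" where
  "X1 = A2"

definition X2 :: "real \<Rightarrow> real^3^3" where
  "X2 a = sqrt (1 - a\<^sup>2) *\<^sub>R A1"

definition SO3 :: "(real^3^3) set" where
  "SO3 = {R. rotation_matrix R}"

text \<open>
  A horizontal curve on \<open>[s, t]\<close> is carried around together with its control
  \<open>u = (u\<^sub>1, u\<^sub>2)\<close>. Since \<open>X1\<close> and \<open>X2 a\<close> are linearly independent for \<open>0 < a < 1\<close>, the curve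
  determines \<open>u\<close> almost everywhere on \<open>[s, t]\<close>, so \<open>sr_length\<close> depends on the curve only.
  Lipschitz continuity is with respect to the Euclidean norm on matrices, which on the compact
  group \<open>SO3\<close> is equivalent to any Riemannian distance.
\<close>

definition horizontal ::
    "real \<Rightarrow> real \<Rightarrow> real \<Rightarrow> (real \<Rightarrow> real^3^3) \<Rightarrow> (real \<Rightarrow> real^2) \<Rightarrow> bool" where
  "horizontal a s t R u \<longleftrightarrow>
     R ` {s..t} \<subseteq> SO3 \<and>
     (\<exists>L. L-lipschitz_on {s..t} R) \<and>
     (AE \<tau> in lebesgue. \<tau> \<in> {s..t} \<longrightarrow>
        (R has_vector_derivative R \<tau> ** (u \<tau> $ 1 *\<^sub>R X1 + u \<tau> $ 2 *\<^sub>R X2 a))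
          (at \<tau> within {s..t}))"

text \<open>The Euclidean norm of \<open>u \<tau>\<close> expresses that \<open>R X1\<close>, \<open>R (X2 a)\<close> are orthonormal.\<close>

definition sr_length :: "real \<Rightarrow> real \<Rightarrow> (real \<Rightarrow> real^2) \<Rightarrow> real" where
  "sr_length s t u = integral {s..t} (\<lambda>\<tau>. norm (u \<tau>))"

text \<open>
  Competitors may be parametrized on the same interval \<open>[s, t]\<close>, because horizontality and length
  are invariant under affine changes of the parameter.
\<close>

definition length_minimizer ::
    "real \<Rightarrow> real \<Rightarrow> real \<Rightarrow> (real \<Rightarrow> real^3^3) \<Rightarrow> (real \<Rightarrow> real^2) \<Rightarrow> bool" where
  "length_minimizer a s t R u \<longleftrightarrow>
     horizontal a s t R u \<and>
     (\<forall>Q v. horizontal a s t Q v \<and> Q s = R s \<and> Q t = R t \<longrightarrow>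
        sr_length s t u \<le> sr_length s t v)"

text \<open>Geodesics defined for all times, parametrized by arclength and starting at the identity.\<close>

definition geodesic :: "real \<Rightarrow> (real \<Rightarrow> real^3^3) \<Rightarrow> bool" where
  "geodesic a R \<longleftrightarrow>
     R 0 = mat 1 \<and>
     (\<exists>u. (\<forall>s t. s < t \<longrightarrow> horizontal a s t R u) \<and>
          (AE \<tau> in lebesgue. norm (u \<tau>) = 1) \<and>
          (\<forall>\<tau>. \<exists>\<epsilon>>0. \<forall>s t. \<tau> - \<epsilon> < s \<and> s < t \<and> t < \<tau> + \<epsilon> \<longrightarrow> length_minimizer a s t R u))"

definition periodic :: "(real \<Rightarrow> real^3^3) \<Rightarrow> bool" where
  "periodic R \<longleftrightarrow> (\<exists>T>0. \<forall>t. R (t + T) = R t)"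

end

theory Submission
  imports Defs
begin

text \<open>
Write \<open>b = sqrt (1 - a\<^sup>2)\<close> and describe the covector \<open>p = (p\<^sub>1, p\<^sub>2, p\<^sub>3)\<close> of an extremal by its body
angular momentum \<open>m = (p\<^sub>2 / b, p\<^sub>1, p\<^sub>3 / b)\<close>. The equations of an extremal are then those of a
degenerate Euler top: \<open>R' = R K\<close> with \<open>K\<close> the cross product with
\<open>\<omega> = (b\<^sup>2 m\<^sub>1, m\<^sub>2, 0)\<close>, and \<open>m' = m \<times> \<omega>\<close>. Hence the spatial momentum \<open>M = R m\<close> is conserved.

The theorem needs only one closed extremal along which \<open>m\<close> never stops. By left invariance, all the
curves \<open>t \<mapsto> R\<^sub>s\<^sup>T R\<^sub>s\<^sub>+\<^sub>t\<close> are again closed extremals from the identity, and they are pairwise different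
as long as their initial velocities differ, which gives a continuum of them.

A closed extremal is found by quadrature. On the energy level the momentum is an angle \<open>\<theta>\<close> moving
with speed \<open>sqrt (C + a\<^sup>2 cos\<^sup>2 \<theta>)\<close>, so it is periodic for every \<open>C > 0\<close>. The rotation is
determined by \<open>m\<close> up to an angle \<open>\<phi>\<close> about the fixed axis \<open>M\<close>, and \<open>d\<phi>/d\<theta>\<close> is explicit
(\<open>precession_rate\<close>). Its integral over one turn of \<open>\<theta>\<close> is positive, continuous in \<open>C\<close> and
tends to \<open>0\<close> as \<open>C\<close> grows, hence equals \<open>2 \<pi> / N\<close> for some \<open>C\<close> and \<open>N\<close>
(\<open>exists_rational_precession\<close>); after \<open>N\<close> periods of the momentum the rotation returns
(\<open>exists_frame_curve\<close>).

That short arcs of an extremal minimize length is shown by calibration (\<open>extremal.calibration\<close>),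
that is, by a local solution \<open>f\<close> of the Hamilton--Jacobi equation which increases at unit rate along the
extremal. The equation is solved explicitly. Fix \<open>e\<close> orthogonal to \<open>M\<close> and look for \<open>f\<close> depending on
\<open>n = Q\<^sup>T e\<close> only. If \<open>m(s)\<close> is orthogonal to \<open>n\<close>, then \<open>R(s) n\<close> lies in the plane orthogonal to
\<open>M\<close>, and \<open>f(n) = s - |M| \<beta>\<close>, where \<open>\<beta>\<close> is the angle of \<open>R(s) n\<close> from \<open>e\<close> in this plane. The
formula is stationary in \<open>s\<close>, because the plane angle turns at rate \<open>m \<bullet> \<omega> / |M| = 1 / |M|\<close>. So
only the motion of \<open>n\<close> contributes, and along a horizontal curve with control \<open>v\<close> the derivative of
\<open>f\<close> is the scalar product of \<open>v\<close> with the unit control of the extremal at time \<open>s\<close>, thus at most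
\<open>|v|\<close>. Integration bounds the length of every competitor from below by that of the extremal; a
competitor leaving the domain of \<open>f\<close> is too long anyway (\<open>calibrated_length_le\<close>). Competitors are
merely Lipschitz, and integrating their derivatives is the purpose of \<open>lipschitz_FTC\<close>.
\<close>

section \<open>Lipschitz curves and the fundamental theorem of calculus\<close>

text \<open>
Changing all functions to \<open>0\<close> on the exceptional set alters no integral and makes the convergence
hold everywhere.
\<close>
lemma dominated_convergence_ae_bounded:
  fixes f :: "nat \<Rightarrow> real \<Rightarrow> 'a::euclidean_space"
  assumes f: "\<And>k. f k integrable_on {s..t}"
    and B: "\<And>k x. x \<in> {s..t} \<Longrightarrow> norm (f k x) \<le> B"
    and N: "negligible N"
    and lim: "\<And>x. x \<in> {s..t} - N \<Longrightarrow> (\<lambda>k. f k x) \<longlonglongrightarrow> g x"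
  shows "g integrable_on {s..t}"
    and "(\<lambda>k. integral {s..t} (f k)) \<longlonglongrightarrow> integral {s..t} g"
proof -
  define f' where "f' k x = (if x \<in> N then 0 else f k x)" for k x
  define g' where "g' x = (if x \<in> N then 0 else g x)" for x
  have int: "f' k integrable_on {s..t}" for k
    by (rule integrable_spike[OF f N]) (auto simp: f'_def)
  have bound: "norm (f' k x) \<le> max B 0" if "x \<in> {s..t}" for k x
    using B[OF that, of k] by (auto simp: f'_def)
  have lim': "(\<lambda>k. f' k x) \<longlonglongrightarrow> g' x" if "x \<in> {s..t}" for x
    using lim[of x] that by (cases "x \<in> N") (auto simp: f'_def g'_def)
  have h: "(\<lambda>x. max B 0) integrable_on {s..t}"
    by (intro integrable_continuous_interval continuous_intros)
  note dc = dominated_convergence[OF int h bound lim']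
  show "g integrable_on {s..t}"
    by (rule integrable_spike[OF dc(1) N]) (auto simp: g'_def)
  have "integral {s..t} (f' k) = integral {s..t} (f k)" for k
    by (rule integral_spike[OF N]) (auto simp: f'_def)
  moreover have "integral {s..t} g' = integral {s..t} g"
    by (rule integral_spike[OF N]) (auto simp: g'_def)
  ultimately show "(\<lambda>k. integral {s..t} (f k)) \<longlonglongrightarrow> integral {s..t} g"
    using dc(2) by simp
qed

text \<open>
Forward difference quotients with step \<open>1 / (k + 1)\<close>. The argument is cut off at the right end
point \<open>t\<close> because \<open>h\<close> is controlled on an interval ending at \<open>t\<close> only.
\<close>
definition diff_quot :: "(real \<Rightarrow> 'a::real_normed_vector) \<Rightarrow> real \<Rightarrow> nat \<Rightarrow> real \<Rightarrow> 'a" where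
  "diff_quot h t k x = real (Suc k) *\<^sub>R (h (min t (x + 1 / real (Suc k))) - h x)"

lemma norm_diff_quot_le:
  assumes h: "L-lipschitz_on {s..t} h" and x: "x \<in> {s..t}"
  shows "norm (diff_quot h t k x) \<le> L"
proof -
  let ?d = "1 / real (Suc k)"
  have "norm (h (min t (x + ?d)) - h x) \<le> L * norm (min t (x + ?d) - x)"
    by (rule lipschitz_on_normD[OF h]) (use x in \<open>auto simp: min_def intro!: add_increasing2\<close>)
  also have "\<dots> \<le> L * ?d"
    using x lipschitz_on_nonneg[OF h] by (intro mult_left_mono) (auto simp: min_def)
  finally have "real (Suc k) * norm (h (min t (x + ?d)) - h x) \<le> real (Suc k) * (L * ?d)"
    by (intro mult_left_mono) auto
  then show ?thesis by (simp add: diff_quot_def)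
qed

lemma continuous_on_diff_quot:
  assumes h: "continuous_on {s..t} h"
  shows "continuous_on {s..t} (diff_quot h t k)"
  unfolding diff_quot_def
  by (intro continuous_intros h continuous_on_compose2[OF h]) (auto simp: min_def add_increasing2)

lemma diff_quot_tendsto:
  assumes h: "(h has_vector_derivative d) (at x within {s..t})" and x: "s \<le> x" "x < t"
  shows "(\<lambda>k. diff_quot h t k x) \<longlonglongrightarrow> d"
proof -
  define \<delta> where "\<delta> k = 1 / real (Suc k)" for k
  have \<delta>0: "\<delta> \<longlonglongrightarrow> 0" unfolding \<delta>_def by (rule LIMSEQ_Suc[OF lim_1_over_n])
  have ev: "\<forall>\<^sub>F k in sequentially. \<delta> k < t - x"
    using x order_tendstoD(2)[OF \<delta>0, of "t - x"] by simp
  have "((\<lambda>y. norm ((h y - h x) - (y - x) *\<^sub>R d) / norm (y - x)) \<longlongrightarrow> 0) (at x within {s..t})"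
    using h by (simp add: has_vector_derivative_def has_derivative_iff_norm)
  moreover have "filterlim (\<lambda>k. x + \<delta> k) (at x within {s..t}) sequentially"
  proof -
    have "(\<lambda>k. x + \<delta> k) \<longlonglongrightarrow> x + 0" by (intro tendsto_intros \<delta>0)
    moreover have "\<forall>\<^sub>F k in sequentially. x + \<delta> k \<in> {s..t} \<and> x + \<delta> k \<noteq> x"
      using ev by eventually_elim (use x in \<open>auto simp: \<delta>_def intro!: add_increasing2\<close>)
    ultimately show ?thesis by (simp add: filterlim_at)
  qed
  ultimately have "(\<lambda>k. norm ((h (x + \<delta> k) - h x) - (x + \<delta> k - x) *\<^sub>R d) / norm (x + \<delta> k - x)) \<longlonglongrightarrow> 0"
    by (rule filterlim_compose)
  moreover have "\<forall>\<^sub>F k in sequentially.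
      norm ((h (x + \<delta> k) - h x) - (x + \<delta> k - x) *\<^sub>R d) / norm (x + \<delta> k - x)
      = norm (diff_quot h t k x - d)"
    using ev
  proof eventually_elim
    case (elim k)
    have "diff_quot h t k x - d = (1 / \<delta> k) *\<^sub>R ((h (x + \<delta> k) - h x) - \<delta> k *\<^sub>R d)"
      using elim by (simp add: diff_quot_def \<delta>_def min_def scaleR_diff_right)
    moreover have "\<delta> k > 0" by (simp add: \<delta>_def)
    ultimately show ?case by simp
  qed
  ultimately have "(\<lambda>k. norm (diff_quot h t k x - d)) \<longlonglongrightarrow> 0"
    by (rule Lim_transform_eventually)
  then show ?thesis
    by (simp add: LIM_zero_iff tendsto_norm_zero_iff)
qed

text \<open>
The difference quotients are bounded by \<open>L\<close> and converge almost everywhere to the derivative, so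
their integrals converge to the integral of the derivative. On the other hand, with a primitive
\<open>F\<close> of \<open>h\<close> (extended by constants) these integrals telescope to a difference quotient of \<open>F\<close> at
\<open>t\<close> minus one at \<open>s\<close>, which converges to \<open>h t - h s\<close>.
\<close>
lemma lipschitz_FTC:
  fixes h :: "real \<Rightarrow> 'a::euclidean_space"
  assumes h: "L-lipschitz_on {s..t} h" and st: "s \<le> t" and N: "negligible N"
    and d: "\<And>x. x \<in> {s..t} - N \<Longrightarrow> (h has_vector_derivative g x) (at x within {s..t})"
  shows "(g has_integral (h t - h s)) {s..t}"
proof -
  have cont: "continuous_on {s..t} h" using h by (rule lipschitz_on_continuous_on)
  define H where "H x = h (max s (min t x))" for x
  have contH: "continuous_on A H" for A
    unfolding H_def by (intro continuous_intros continuous_on_compose2[OF cont]) (use st in auto)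
  define F where "F x = integral {s..x} H" for x
  have F: "(F has_vector_derivative H x) (at x within {s..t+1})" if "x \<in> {s..t+1}" for x
    unfolding F_def by (rule integral_has_vector_derivative[OF contH that])
  have F_diff: "integral {s..t} (diff_quot h t k) = diff_quot F (t+1) k t - diff_quot F (t+1) k s" for k
  proof -
    let ?d = "1 / real (Suc k)"
    have d: "0 < ?d" "?d \<le> 1" by auto
    have 1: "integral {s..t} (diff_quot h t k) = integral {s..t} (\<lambda>x. real (Suc k) *\<^sub>R (H (x + ?d) - H x))"
      by (rule integral_cong) (auto simp: diff_quot_def H_def max_absorb2 add_increasing2)
    have 2: "((\<lambda>x. H (x + ?d)) has_integral (F (t + ?d) - F (s + ?d))) {s..t}"
    proof (rule fundamental_theorem_of_calculus[OF st])
      fix x assume x: "x \<in> {s..t}"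
      have "(F has_vector_derivative H (x + ?d)) (at (x + ?d) within {s..t+1})"
        by (rule F) (use x d in \<open>unfold atLeastAtMost_iff, linarith\<close>)
      then have "(F has_vector_derivative H (x + ?d)) (at (x + ?d) within (\<lambda>x. x + ?d) ` {s..t})"
        by (rule has_vector_derivative_within_subset) (use d in auto)
      then have "(F \<circ> (\<lambda>x. x + ?d) has_vector_derivative 1 *\<^sub>R H (x + ?d)) (at x within {s..t})"
        by (intro vector_diff_chain_within) (auto intro!: derivative_eq_intros)
      then show "((\<lambda>x. F (x + ?d)) has_vector_derivative H (x + ?d)) (at x within {s..t})"
        by (simp add: o_def)
    qed
    have 3: "(H has_integral (F t - F s)) {s..t}"
      by (rule fundamental_theorem_of_calculus[OF st])
         (auto intro!: has_vector_derivative_within_subset[OF F])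
    have "((\<lambda>x. real (Suc k) *\<^sub>R (H (x + ?d) - H x)) has_integral
        real (Suc k) *\<^sub>R ((F (t + ?d) - F (s + ?d)) - (F t - F s))) {s..t}"
      by (intro has_integral_cmul has_integral_diff 2 3)
    then have "integral {s..t} (diff_quot h t k)
        = real (Suc k) *\<^sub>R ((F (t + ?d) - F (s + ?d)) - (F t - F s))"
      unfolding 1 by (rule integral_unique)
    moreover have "min (t + 1) (t + ?d) = t + ?d" "min (t + 1) (s + ?d) = s + ?d"
      using d st by linarith+
    ultimately show ?thesis
      by (simp add: diff_quot_def scaleR_diff_right)
  qed
  have lim: "(\<lambda>k. diff_quot h t k x) \<longlonglongrightarrow> g x" if "x \<in> {s..t} - insert t N" for x
    by (rule diff_quot_tendsto[OF d]) (use that in auto)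
  have int: "diff_quot h t k integrable_on {s..t}" for k
    by (intro integrable_continuous_interval continuous_on_diff_quot cont)
  have N': "negligible (insert t N)" using N by simp
  note dc = dominated_convergence_ae_bounded[OF int norm_diff_quot_le[OF h] N' lim]
  have "(\<lambda>k. integral {s..t} (diff_quot h t k)) \<longlonglongrightarrow> H t - H s"
    unfolding F_diff by (intro tendsto_diff diff_quot_tendsto[OF F]) (use st in auto)
  then have "integral {s..t} g = h t - h s"
    using LIMSEQ_unique[OF dc(2)] st by (auto simp: H_def)
  with dc(1) show ?thesis using integrable_integral by fastforce
qed

text \<open>
The derivative bound may fail on \<open>N\<close>; replacing the derivative by the bound \<open>q\<close> there turns it into
a pointwise one.
\<close>
lemma lipschitz_increment_le:
  fixes h :: "real \<Rightarrow> real"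
  assumes h: "L-lipschitz_on {s..t} h" and st: "s \<le> t" and q: "q integrable_on {s..t}"
    and N: "negligible N"
    and d: "\<And>x. x \<in> {s..t} - N \<Longrightarrow> \<exists>d \<le> q x. (h has_vector_derivative d) (at x within {s..t})"
  shows "h t - h s \<le> integral {s..t} q"
proof -
  obtain g0 where g0: "\<And>x. x \<in> {s..t} - N \<Longrightarrow>
      g0 x \<le> q x \<and> (h has_vector_derivative g0 x) (at x within {s..t})"
    using d by metis
  define g where "g x = (if x \<in> N then q x else g0 x)" for x
  have "(g has_integral (h t - h s)) {s..t}"
    by (rule lipschitz_FTC[OF h st N]) (use g0 in \<open>auto simp: g_def\<close>)
  then show ?thesis
    by (rule has_integral_le[OF _ integrable_integral[OF q]]) (use g0 in \<open>auto simp: g_def\<close>)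
qed

section \<open>Matrix calculus and the rotation group\<close>

unbundle cross3_syntax

\<comment> \<open>Keeps \<open>transpose A *v x\<close> from being rewritten into a product with a row vector.\<close>
declare transpose_matrix_vector [simp del]

lemma bounded_bilinear_matrix_vector: "bounded_bilinear ((*v) :: real^'n^'m \<Rightarrow> real^'n \<Rightarrow> real^'m)"
  unfolding bilinear_conv_bounded_bilinear[symmetric] bilinear_def
  by (auto intro!: linearI simp: matrix_vector_mult_add_rdistrib matrix_vector_right_distrib
      scaleR_matrix_vector_assoc[symmetric] matrix_vector_mult_scaleR)

lemma bounded_bilinear_matrix_matrix:
  "bounded_bilinear ((**) :: real^'n^'m \<Rightarrow> real^'k^'n \<Rightarrow> real^'k^'m)"
  unfolding bilinear_conv_bounded_bilinear[symmetric] bilinear_def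
  by (auto intro!: linearI simp: matrix_matrix_mult_def vec_eq_iff sum.distrib algebra_simps sum_distrib_left)

lemma bounded_linear_transpose: "bounded_linear (transpose :: real^'n^'m \<Rightarrow> real^'m^'n)"
  by (auto intro!: linear_conv_bounded_linear[THEN iffD1] linearI simp: transpose_def vec_eq_iff)

lemma bounded_bilinear_cross: "bounded_bilinear (\<times>)"
  using bilinear_cross by (simp add: bilinear_conv_bounded_bilinear)

lemmas has_vector_derivative_matrix_vector [derivative_intros] =
  bounded_bilinear.has_vector_derivative[OF bounded_bilinear_matrix_vector]
lemmas has_vector_derivative_matrix_matrix [derivative_intros] =
  bounded_bilinear.has_vector_derivative[OF bounded_bilinear_matrix_matrix]
lemmas has_vector_derivative_cross [derivative_intros] =
  bounded_bilinear.has_vector_derivative[OF bounded_bilinear_cross]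
lemmas has_vector_derivative_transpose [derivative_intros] =
  bounded_linear.has_vector_derivative[OF bounded_linear_transpose]

definition control_matrix :: "real \<Rightarrow> real^2 \<Rightarrow> real^3^3" where
  "control_matrix a u = u $ 1 *\<^sub>R X1 + u $ 2 *\<^sub>R X2 a"

text \<open>
The axial vector of the skew matrix \<open>control_matrix a u\<close>.
\<close>
definition angular_velocity :: "real \<Rightarrow> real^2 \<Rightarrow> real^3" where
  "angular_velocity a u = vector [sqrt (1 - a\<^sup>2) * u $ 2, u $ 1, 0]"

lemma control_matrix_mult_vec: "control_matrix a u *v x = angular_velocity a u \<times> x"
  by (simp add: control_matrix_def angular_velocity_def X1_def X2_def A1_def A2_def cross3_def
      matrix_vector_mult_def vec_eq_iff forall_3 sum_3 vector_3)

lemma transpose_control_matrix: "transpose (control_matrix a u) = - control_matrix a u"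
  by (simp add: control_matrix_def X1_def X2_def A1_def A2_def
      transpose_def vec_eq_iff forall_3 vector_3)

lemma norm_angular_velocity_le: "norm (angular_velocity a u) \<le> norm u" if "0 < a" "a < 1"
proof -
  have "(1 - a\<^sup>2) * (u $ 2)\<^sup>2 \<le> (u $ 2)\<^sup>2"
    by (simp add: algebra_simps)
  moreover have "a\<^sup>2 \<le> 1" using that by (simp add: power_le_one)
  ultimately have "angular_velocity a u \<bullet> angular_velocity a u \<le> u \<bullet> u"
    by (simp add: angular_velocity_def inner_vec_def sum_3 sum_2 vector_3 power2_eq_square[symmetric]
        power_mult_distrib)
  then show ?thesis by (simp add: norm_le)
qed

lemma in_SO3D:
  assumes "A \<in> SO3"
  shows "transpose A ** A = mat 1" "A ** transpose A = mat 1"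
    "(A *v x) \<bullet> (A *v y) = x \<bullet> y" "norm (A *v x) = norm x" "norm (transpose A *v x) = norm x"
    "(A *v x) \<times> (A *v y) = A *v (x \<times> y)"
    "A *v (transpose A *v x) = x" "transpose A *v (A *v x) = x"
proof -
  have r: "rotation_matrix A" and o: "orthogonal_matrix A" using assms
    by (auto simp: SO3_def rotation_matrix_def)
  show 1: "transpose A ** A = mat 1" "A ** transpose A = mat 1" using o by (auto simp: orthogonal_matrix_def)
  have ot: "orthogonal_transformation ((*v) A)" "orthogonal_transformation ((*v) (transpose A))"
    using o by (simp_all add: orthogonal_transformation_matrix orthogonal_matrix_transpose)
  then show "norm (A *v x) = norm x" "norm (transpose A *v x) = norm x"
    by (auto simp: orthogonal_transformation)
  show "(A *v x) \<bullet> (A *v y) = x \<bullet> y"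
    using ot(1) by (auto simp: orthogonal_transformation_def)
  show "(A *v x) \<times> (A *v y) = A *v (x \<times> y)" using r by (rule cross_rotation_matrix)
  show "A *v (transpose A *v x) = x" "transpose A *v (A *v x) = x"
    by (simp_all add: matrix_vector_mul_assoc 1)
qed

text \<open>
Seen from the moving frame \<open>Q\<close>, a fixed spatial vector \<open>e\<close> rotates with the opposite angular velocity.
\<close>
lemma transpose_curve_derivative:
  assumes "(Q has_vector_derivative Q t ** control_matrix a u) (at t within S)"
  shows "((\<lambda>t. transpose (Q t) *v e) has_vector_derivative
      - (angular_velocity a u \<times> (transpose (Q t) *v e))) (at t within S)"
  by (auto intro!: derivative_eq_intros assms simp: matrix_transpose_mul transpose_control_matrix
      control_matrix_mult_vec[symmetric] matrix_vector_mul_assoc[symmetric]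
      bounded_bilinear.minus_left[OF bounded_bilinear_matrix_vector])

text \<open>
Two facts on the plane orthogonal to \<open>M\<close>, in which \<open>e\<close> and \<open>M \<times> e\<close> form an orthogonal basis. The
first computes the areal speed, in this basis, of a vector \<open>y\<close> that rotates with angular velocity
\<open>z\<close>: only the component of \<open>z\<close> along \<open>M\<close> matters. The second is Pythagoras' theorem.
\<close>
lemma planar_rate_identity:
  fixes e M y z :: "real^3"
  assumes "e \<bullet> M = 0" "y \<bullet> M = 0"
  shows "(y \<bullet> e) * ((z \<times> y) \<bullet> (M \<times> e)) - (y \<bullet> (M \<times> e)) * ((z \<times> y) \<bullet> e)
    = (e \<bullet> e) * (y \<bullet> y) * (M \<bullet> z)"
proof -
  have "(y \<bullet> e) * (p \<bullet> (M \<times> e)) - (y \<bullet> (M \<times> e)) * (p \<bullet> e)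
      = (e \<bullet> e) * (M \<bullet> (y \<times> p)) - (e \<bullet> M) * (e \<bullet> (y \<times> p))" for p
    by (simp add: cross3_simps)
  moreover have "M \<bullet> (y \<times> (z \<times> y)) = (y \<bullet> y) * (M \<bullet> z) - (y \<bullet> M) * (y \<bullet> z)"
    by (simp add: cross3_simps)
  ultimately show ?thesis using assms by simp
qed

lemma planar_norm_identity:
  fixes e M y :: "real^3"
  assumes "e \<bullet> M = 0" "y \<bullet> M = 0"
  shows "(M \<bullet> M) * (y \<bullet> e)\<^sup>2 + (y \<bullet> (M \<times> e))\<^sup>2 = (M \<bullet> M) * (e \<bullet> e) * (y \<bullet> y)"
proof -
  have "(M \<times> y) \<bullet> (M \<times> e) = (M \<bullet> M) * (y \<bullet> e) - (e \<bullet> M) * (y \<bullet> M)"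
    by (simp add: cross3_simps)
  moreover have "(M \<times> y) \<bullet> e = - (y \<bullet> (M \<times> e))"
    by (simp add: cross3_simps)
  ultimately show ?thesis
    using planar_rate_identity[OF assms, of M] assms by (simp add: power2_eq_square algebra_simps)
qed

section \<open>Length bounds for horizontal curves\<close>

lemma norm_cross_le: "norm (x \<times> y) \<le> norm x * norm y"
  using norm_cross_dot[of x y] by (metis abs_le_square_iff abs_norm_cancel abs_mult le_add_same_cancel1 zero_le_power2)

lemma horizontalE:
  assumes "horizontal a s t Q v"
  obtains L N where "L-lipschitz_on {s..t} Q" "negligible N" "\<And>\<tau>. \<tau> \<in> {s..t} \<Longrightarrow> Q \<tau> \<in> SO3"
    "\<And>\<tau>. \<tau> \<in> {s..t} - N \<Longrightarrow>
      (Q has_vector_derivative Q \<tau> ** control_matrix a (v \<tau>)) (at \<tau> within {s..t})"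
proof -
  have "AE \<tau> in lebesgue. \<tau> \<in> {s..t} \<longrightarrow>
      (Q has_vector_derivative Q \<tau> ** control_matrix a (v \<tau>)) (at \<tau> within {s..t})"
    and "Q ` {s..t} \<subseteq> SO3" and "\<exists>L. L-lipschitz_on {s..t} Q"
    using assms by (auto simp: horizontal_def control_matrix_def)
  then show ?thesis
    using that unfolding eventually_ae_filter_negligible by blast
qed

lemma horizontal_subinterval:
  assumes "horizontal a s t Q v" "s \<le> s'" "t' \<le> t"
  shows "horizontal a s' t' Q v"
proof -
  have sub: "{s'..t'} \<subseteq> {s..t}" using assms by auto
  have "AE \<tau> in lebesgue. \<tau> \<in> {s'..t'} \<longrightarrow>
      (Q has_vector_derivative Q \<tau> ** (v \<tau> $ 1 *\<^sub>R X1 + v \<tau> $ 2 *\<^sub>R X2 a)) (at \<tau> within {s'..t'})"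
    using assms(1) unfolding horizontal_def
    using sub
    by (auto elim!: eventually_mono intro!: has_vector_derivative_within_subset[OF _ sub])
  then show ?thesis
    using assms(1) sub unfolding horizontal_def by (blast intro: lipschitz_on_subset)
qed

text \<open>
The control is determined almost everywhere by the derivative of the curve, so its norm is an almost
everywhere limit of bounded continuous functions of the difference quotients. Without this fact the
length, an integral with value \<open>0\<close> on non-integrable functions, could not be bounded from below.
\<close>
lemma horizontal_speed_integrable:
  assumes hor: "horizontal a s t Q v" and a: "0 < a" "a < 1"
  shows "(\<lambda>\<tau>. norm (v \<tau>)) integrable_on {s..t}"
proof -
  obtain L N where L: "L-lipschitz_on {s..t} Q" and N: "negligible N"
    and SO3: "\<And>\<tau>. \<tau> \<in> {s..t} \<Longrightarrow> Q \<tau> \<in> SO3"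
    and d: "\<And>\<tau>. \<tau> \<in> {s..t} - N \<Longrightarrow>
      (Q has_vector_derivative Q \<tau> ** control_matrix a (v \<tau>)) (at \<tau> within {s..t})"
    using horizontalE[OF hor] by blast
  define b where "b = sqrt (1 - a\<^sup>2)"
  have b: "b > 0" using a by (simp add: b_def power_less_one_iff abs_square_less_1)
  \<comment> \<open>A function recovering \<open>norm u\<close> from the entries of \<open>control_matrix a u\<close>.\<close>
  define c :: "real^3^3 \<Rightarrow> real" where "c A = sqrt ((A $ 1 $ 3)\<^sup>2 + (A $ 3 $ 2 / b)\<^sup>2)" for A
  have c: "c (control_matrix a u) = norm u" for u
    using b by (simp add: c_def norm_vec_def L2_set_def sum_2 control_matrix_def X1_def X2_def A1_def A2_def
        b_def[symmetric] vector_3)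
  have cont_c: "continuous_on S c" for S
    unfolding c_def using b by (intro continuous_intros) auto
  have c_le: "norm (c A) \<le> (1 + 1/b) * norm A" for A
  proof -
    have entry: "\<bar>A $ i $ j\<bar> \<le> norm A" for i j
      by (rule order_trans[OF component_le_norm_cart Finite_Cartesian_Product.norm_nth_le])
    have "norm (c A) \<le> \<bar>A $ 1 $ 3\<bar> + \<bar>A $ 3 $ 2 / b\<bar>"
      unfolding c_def using sqrt_sum_squares_le_sum_abs[of "A $ 1 $ 3" "A $ 3 $ 2 / b"] by (simp del: abs_divide)
    also have "\<dots> \<le> norm A + norm A / b"
      unfolding abs_divide abs_of_pos[OF b]
      using b by (intro add_mono divide_right_mono entry) auto
    finally show ?thesis by (simp add: algebra_simps)
  qed
  have contQ: "continuous_on {s..t} Q" using L by (rule lipschitz_on_continuous_on)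
  have contT: "continuous_on {s..t} (\<lambda>\<tau>. transpose (Q \<tau>))"
    by (rule bounded_linear.continuous_on[OF bounded_linear_transpose contQ])
  obtain B where B: "\<And>\<tau>. \<tau> \<in> {s..t} \<Longrightarrow> norm (transpose (Q \<tau>)) \<le> B"
    using compact_imp_bounded[OF compact_continuous_image[OF contT compact_Icc]]
    unfolding bounded_iff by blast
  have "\<exists>K>0. \<forall>(A::real^3^3) (B::real^3^3). norm (A ** B) \<le> norm A * norm B * K"
    by (rule bounded_bilinear.pos_bounded[OF bounded_bilinear_matrix_matrix])
  then obtain K where K: "K > 0" "\<And>(A::real^3^3) (B::real^3^3). norm (A ** B) \<le> norm A * norm B * K"
    by blast
  define f where "f k \<tau> = c (transpose (Q \<tau>) ** diff_quot Q t k \<tau>)" for k \<tau>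
  have int: "f k integrable_on {s..t}" for k
    unfolding f_def
    by (intro integrable_continuous_interval continuous_on_compose2[OF cont_c]
      bounded_bilinear.continuous_on[OF bounded_bilinear_matrix_matrix] contT continuous_on_diff_quot[OF contQ]) auto
  have bound: "norm (f k \<tau>) \<le> (1 + 1/b) * (B * L * K)" if \<tau>: "\<tau> \<in> {s..t}" for k \<tau>
  proof -
    have "norm (transpose (Q \<tau>) ** diff_quot Q t k \<tau>) \<le> norm (transpose (Q \<tau>)) * norm (diff_quot Q t k \<tau>) * K"
      by (rule K)
    also have "\<dots> \<le> B * L * K"
      using B[OF \<tau>] norm_diff_quot_le[OF L \<tau>, of k] K(1) order_trans[OF norm_ge_zero B[OF \<tau>]]
      by (intro mult_right_mono mult_mono) auto
    finally show ?thesis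
      unfolding f_def using b by (intro order_trans[OF c_le] mult_left_mono) auto
  qed
  have lim: "(\<lambda>k. f k \<tau>) \<longlonglongrightarrow> norm (v \<tau>)" if \<tau>: "\<tau> \<in> {s..t} - insert t N" for \<tau>
  proof -
    have "(\<lambda>k. diff_quot Q t k \<tau>) \<longlonglongrightarrow> Q \<tau> ** control_matrix a (v \<tau>)"
      by (rule diff_quot_tendsto[OF d]) (use \<tau> in auto)
    then have "(\<lambda>k. transpose (Q \<tau>) ** diff_quot Q t k \<tau>) \<longlonglongrightarrow>
        transpose (Q \<tau>) ** (Q \<tau> ** control_matrix a (v \<tau>))"
      by (intro bounded_bilinear.tendsto[OF bounded_bilinear_matrix_matrix] tendsto_const)
    also have "transpose (Q \<tau>) ** (Q \<tau> ** control_matrix a (v \<tau>)) = control_matrix a (v \<tau>)"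
      using in_SO3D(1)[OF SO3] \<tau> by (simp add: matrix_mul_assoc)
    finally have "(\<lambda>k. c (transpose (Q \<tau>) ** diff_quot Q t k \<tau>)) \<longlonglongrightarrow> c (control_matrix a (v \<tau>))"
      using cont_c[of UNIV] by (auto simp: continuous_on_eq_continuous_at intro: isCont_tendsto_compose)
    then show ?thesis by (simp add: f_def c)
  qed
  have N': "negligible (insert t N)" using N by simp
  show ?thesis
    by (rule dominated_convergence_ae_bounded(1)[OF int bound N' lim])
qed

lemma transpose_curve_lipschitz:
  fixes Q :: "real \<Rightarrow> real^3^3"
  assumes "L-lipschitz_on S Q"
  obtains L' where "L'-lipschitz_on S (\<lambda>\<tau>. transpose (Q \<tau>) *v e)"
proof -
  have "bounded_linear (\<lambda>A::real^3^3. transpose A *v e)"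
    by (rule bounded_linear_compose[OF bounded_bilinear.bounded_linear_left[OF bounded_bilinear_matrix_vector]
        bounded_linear_transpose])
  from bounded_linear.lipschitz_boundE[OF this] obtain B where "B-lipschitz_on (Q ` S) (\<lambda>A. transpose A *v e)" by metis
  from lipschitz_on_compose2[OF assms this] show ?thesis by (rule that)
qed

text \<open>
The calibration inequality for a function that depends on \<open>Q\<close> through \<open>n = Q\<^sup>T e\<close> only: if its
derivative along every horizontal direction is at most \<open>C\<close> times the norm of the control, then its
increment is at most \<open>C\<close> times the length. The bound \<open>B\<close> on the whole gradient serves to make the
composition with the curve Lipschitz.
\<close>
lemma horizontal_calibration:
  assumes hor: "horizontal a s t Q v" and st: "s \<le> t" and a: "0 < a" "a < 1"
    and S: "convex S" "(\<lambda>\<tau>. transpose (Q \<tau>) *v e) ` {s..t} \<subseteq> S"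
    and f: "\<And>n. n \<in> S \<Longrightarrow> (f has_derivative f' n) (at n)"
    and B: "\<And>n w. n \<in> S \<Longrightarrow> \<bar>f' n w\<bar> \<le> B * norm w"
    and q: "\<And>n u. n \<in> S \<Longrightarrow> norm n = norm e \<Longrightarrow> f' n (- (angular_velocity a u \<times> n)) \<le> C * norm u"
  shows "f (transpose (Q t) *v e) - f (transpose (Q s) *v e) \<le> C * integral {s..t} (\<lambda>\<tau>. norm (v \<tau>))"
proof -
  obtain L N where L: "L-lipschitz_on {s..t} Q" and N: "negligible N"
    and SO3: "\<And>\<tau>. \<tau> \<in> {s..t} \<Longrightarrow> Q \<tau> \<in> SO3"
    and d: "\<And>\<tau>. \<tau> \<in> {s..t} - N \<Longrightarrow>
      (Q has_vector_derivative Q \<tau> ** control_matrix a (v \<tau>)) (at \<tau> within {s..t})"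
    using horizontalE[OF hor] by blast
  define n where "n \<tau> = transpose (Q \<tau>) *v e" for \<tau>
  have nS: "n \<tau> \<in> S" if "\<tau> \<in> {s..t}" for \<tau> using S that by (auto simp: n_def)
  obtain L' where L': "L'-lipschitz_on {s..t} n"
    using transpose_curve_lipschitz[OF L, of e] unfolding n_def .
  have "onorm (f' x) \<le> max B 0" if "x \<in> S" for x
    by (rule onorm_bound) (auto intro!: order_trans[OF B[OF that]] mult_right_mono)
  then have "(max B 0)-lipschitz_on S f"
    by (intro bounded_derivative_imp_lipschitz[OF has_derivative_at_withinI[OF f] S(1)]) auto
  then have "(max B 0)-lipschitz_on (n ` {s..t}) f"
    by (rule lipschitz_on_subset) (use nS in auto)
  from lipschitz_on_compose2[OF L' this]
  have lip: "(max B 0 * L')-lipschitz_on {s..t} (\<lambda>\<tau>. f (n \<tau>))" .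
  have "f (n t) - f (n s) \<le> integral {s..t} (\<lambda>\<tau>. C * norm (v \<tau>))"
  proof (rule lipschitz_increment_le[OF lip st _ N])
    show "(\<lambda>\<tau>. C * norm (v \<tau>)) integrable_on {s..t}"
      by (rule integrable_on_mult_right[OF horizontal_speed_integrable[OF hor a]])
    fix \<tau> assume \<tau>: "\<tau> \<in> {s..t} - N"
    let ?d = "- (angular_velocity a (v \<tau>) \<times> n \<tau>)"
    have "(n has_vector_derivative ?d) (at \<tau> within {s..t})"
      unfolding n_def by (rule transpose_curve_derivative[where Q=Q, OF d[OF \<tau>]])
    moreover have "(f has_derivative f' (n \<tau>)) (at (n \<tau>) within n ` {s..t})"
      by (rule has_derivative_at_withinI[OF f[OF nS]]) (use \<tau> in auto)
    ultimately have "((\<lambda>\<tau>. f (n \<tau>)) has_vector_derivative f' (n \<tau>) ?d) (at \<tau> within {s..t})"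
      using vector_derivative_diff_chain_within[of n ?d \<tau> "{s..t}" f "f' (n \<tau>)"] by (simp add: o_def)
    moreover have "f' (n \<tau>) ?d \<le> C * norm (v \<tau>)"
      by (rule q[OF nS]) (use \<tau> in \<open>auto simp: n_def in_SO3D(5)[OF SO3]\<close>)
    ultimately show "\<exists>d\<le>C * norm (v \<tau>). ((\<lambda>\<tau>. f (n \<tau>)) has_vector_derivative d) (at \<tau> within {s..t})"
      by blast
  qed
  then show ?thesis by (simp add: n_def)
qed

text \<open>
The linear function \<open>n \<mapsto> w \<bullet> n\<close>, where \<open>w\<close> is the displacement itself, is a calibration with constant
\<open>|w| |e|\<close>, and its increment is \<open>|w|\<^sup>2\<close>.
\<close>
lemma horizontal_displacement_le:
  assumes hor: "horizontal a s t Q v" and st: "s \<le> t" and a: "0 < a" "a < 1"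
  shows "norm (transpose (Q t) *v e - transpose (Q s) *v e) \<le> norm e * integral {s..t} (\<lambda>\<tau>. norm (v \<tau>))"
proof -
  let ?w = "transpose (Q t) *v e - transpose (Q s) *v e"
  have "?w \<bullet> (transpose (Q t) *v e) - ?w \<bullet> (transpose (Q s) *v e)
      \<le> (norm ?w * norm e) * integral {s..t} (\<lambda>\<tau>. norm (v \<tau>))"
  proof (rule horizontal_calibration[OF hor st a, where S=UNIV and f' = "\<lambda>n. (\<bullet>) ?w" and B="norm ?w"])
    show "((\<bullet>) ?w has_derivative (\<bullet>) ?w) (at n)" for n
      by (rule bounded_linear_imp_has_derivative[OF bounded_linear_inner_right])
    show "\<bar>?w \<bullet> x\<bar> \<le> norm ?w * norm x" for x by (rule Cauchy_Schwarz_ineq2)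
    fix n :: "real^3" and u :: "real^2" assume n: "norm n = norm e"
    have "?w \<bullet> - (angular_velocity a u \<times> n) \<le> norm ?w * norm (- (angular_velocity a u \<times> n))"
      by (rule norm_cauchy_schwarz)
    also have "\<dots> \<le> norm ?w * (norm u * norm e)"
      unfolding norm_minus_cancel n[symmetric]
      by (intro mult_left_mono order_trans[OF norm_cross_le] mult_right_mono norm_angular_velocity_le a) auto
    finally show "?w \<bullet> - (angular_velocity a u \<times> n) \<le> norm ?w * norm e * norm u"
      by (simp only: mult.assoc mult.commute[of "norm u"])
  qed auto
  then have le: "norm ?w * norm ?w \<le> norm ?w * (norm e * integral {s..t} (\<lambda>\<tau>. norm (v \<tau>)))"
    unfolding inner_diff_right[symmetric] power2_norm_eq_inner[symmetric]
    by (simp only: power2_eq_square mult.assoc)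
  show ?thesis
  proof (cases "?w = 0")
    case True
    have "0 \<le> norm e * integral {s..t} (\<lambda>\<tau>. norm (v \<tau>))"
      by (intro mult_nonneg_nonneg integral_nonneg horizontal_speed_integrable[OF hor a]) auto
    then show ?thesis by (simp only: True norm_zero)
  next
    case False
    then show ?thesis using mult_left_le_imp_le[OF le] by simp
  qed
qed

text \<open>
A local calibration suffices for short arcs. A curve that stays in the ball obeys the calibration
inequality. A curve that starts in the half ball and leaves the ball moves \<open>n\<close> by at least
\<open>r / 2\<close>, so its length is at least \<open>r / (2 |e|)\<close>, which is no less than the increment of \<open>f\<close>.
\<close>
lemma calibrated_length_le:
  assumes hor: "horizontal a s t Q v" and st: "s \<le> t" and a: "0 < a" "a < 1"
    and start: "transpose (Q s) *v e \<in> ball n0 (r / 2)" and e: "e \<noteq> 0"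
    and f: "\<And>n. n \<in> ball n0 r \<Longrightarrow> (f has_derivative f' n) (at n)"
    and B: "\<And>n w. n \<in> ball n0 r \<Longrightarrow> \<bar>f' n w\<bar> \<le> B * norm w"
    and q: "\<And>n u. n \<in> ball n0 r \<Longrightarrow> norm n = norm e \<Longrightarrow> f' n (- (angular_velocity a u \<times> n)) \<le> norm u"
    and short: "f (transpose (Q t) *v e) - f (transpose (Q s) *v e) \<le> r / (2 * norm e)"
  shows "f (transpose (Q t) *v e) - f (transpose (Q s) *v e) \<le> sr_length s t v"
proof (cases "(\<lambda>\<tau>. transpose (Q \<tau>) *v e) ` {s..t} \<subseteq> ball n0 r")
  case True
  have "f (transpose (Q t) *v e) - f (transpose (Q s) *v e) \<le> 1 * integral {s..t} (\<lambda>\<tau>. norm (v \<tau>))"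
    by (rule horizontal_calibration[OF hor st a convex_ball True f B]) (use q in auto)
  then show ?thesis by (simp add: sr_length_def)
next
  case False
  then obtain \<tau> where \<tau>: "\<tau> \<in> {s..t}" "dist n0 (transpose (Q \<tau>) *v e) \<ge> r" by force
  have hor': "horizontal a s \<tau> Q v" by (rule horizontal_subinterval[OF hor]) (use \<tau> in auto)
  have "r \<le> dist n0 (transpose (Q s) *v e) + dist (transpose (Q s) *v e) (transpose (Q \<tau>) *v e)"
    using \<tau>(2) dist_triangle order_trans by blast
  then have "r / 2 \<le> norm (transpose (Q \<tau>) *v e - transpose (Q s) *v e)"
    using start by (simp add: dist_norm norm_minus_commute)
  also have "\<dots> \<le> norm e * integral {s..\<tau>} (\<lambda>\<tau>. norm (v \<tau>))"
    by (rule horizontal_displacement_le[OF hor' _ a]) (use \<tau> in auto)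
  also have "\<dots> \<le> norm e * integral {s..t} (\<lambda>\<tau>. norm (v \<tau>))"
    by (intro mult_left_mono integral_subset_le horizontal_speed_integrable[OF hor a]
        horizontal_speed_integrable[OF hor' a]) (use \<tau> in auto)
  finally have "r / (2 * norm e) \<le> sr_length s t v"
    using e by (simp add: sr_length_def field_simps)
  then show ?thesis using short by linarith
qed

section \<open>Regular extremals are geodesics\<close>

text \<open>
The implicit function theorem for the equation \<open>m s \<bullet> n = 0\<close>, solved for the time \<open>s = \<sigma> n\<close>. It
comes from the inverse function theorem for \<open>(s, n) \<mapsto> (m s \<bullet> n, n)\<close>; the neighbourhood \<open>W\<close>
carries the local uniqueness of the solution.
\<close>
lemma implicit_time:
  fixes m m' :: "real \<Rightarrow> real^3"
  assumes m: "\<And>t. (m has_vector_derivative m' t) (at t)" and m': "continuous_on UNIV m'"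
    and zero: "m \<tau> \<bullet> n0 = 0" and trans: "m' \<tau> \<bullet> n0 \<noteq> 0"
  obtains \<sigma> \<sigma>' V W where "open V" "open W" "(\<tau>, n0) \<in> W"
    "\<And>n. n \<in> V \<Longrightarrow> (\<sigma> has_derivative \<sigma>' n) (at n)" "\<And>n. n \<in> V \<Longrightarrow> m (\<sigma> n) \<bullet> n = 0"
    "\<And>s n. (s, n) \<in> W \<Longrightarrow> m s \<bullet> n = 0 \<Longrightarrow> n \<in> V \<and> \<sigma> n = s"
proof -
  define F where "F x = (m (fst x) \<bullet> snd x, snd x)" for x
  define D where "D x = (\<lambda>h. (fst h * (m' (fst x) \<bullet> snd x) + m (fst x) \<bullet> snd h, snd h))" for x
  have blD: "bounded_linear (D x)" for x
    unfolding D_def linear_conv_bounded_linear[symmetric]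
    by (auto intro!: linearI simp: algebra_simps inner_add_right)
  have contm: "continuous_on UNIV m"
    by (meson m continuous_at_imp_continuous_on has_vector_derivative_continuous)
  have 1: "(F has_derivative blinfun_apply (Blinfun (D x))) (at x)" for x
  proof -
    have "((\<lambda>x. m (fst x)) has_derivative (\<lambda>h. fst h *\<^sub>R m' (fst x))) (at x)"
      by (rule has_derivative_compose[OF has_derivative_fst[OF has_derivative_ident]
          m[unfolded has_vector_derivative_def]])
    from has_derivative_Pair[OF has_derivative_inner[OF this has_derivative_snd[OF has_derivative_ident]]
        has_derivative_snd[OF has_derivative_ident]]
    show ?thesis
      unfolding F_def bounded_linear_Blinfun_apply[OF blD] by (simp add: D_def add.commute)
  qed
  have 2: "continuous_on UNIV (\<lambda>x. Blinfun (D x))"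
  proof (rule continuous_on_blinfun_componentwise)
    fix i :: "real \<times> (real^3)"
    have [continuous_intros]: "continuous_on UNIV (\<lambda>x::real \<times> (real^3). m (fst x))"
      "continuous_on UNIV (\<lambda>x::real \<times> (real^3). m' (fst x))"
      by (auto intro!: continuous_on_compose2[OF contm] continuous_on_compose2[OF m'] continuous_intros)
    show "continuous_on UNIV (\<lambda>x. blinfun_apply (Blinfun (D x)) i)"
      unfolding bounded_linear_Blinfun_apply[OF blD] by (simp add: D_def) (intro continuous_intros)
  qed
  define I where "I = (\<lambda>h. ((fst h - m \<tau> \<bullet> snd h) / (m' \<tau> \<bullet> n0), snd h))"
  have blI: "bounded_linear I"
    unfolding I_def linear_conv_bounded_linear[symmetric]
    by (auto intro!: linearI simp: diff_divide_distrib add_divide_distrib algebra_simps inner_add_right)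
  have 3: "Blinfun I o\<^sub>L Blinfun (D (\<tau>, n0)) = id_blinfun"
    by (rule blinfun_eqI) (use trans in \<open>simp add: bounded_linear_Blinfun_apply blD blI, simp add: I_def D_def\<close>)
  obtain U V g g' where U: "open U" "(\<tau>, n0) \<in> U" and V: "open V" and hom: "homeomorphism U V F g"
    and g: "\<And>y. y \<in> V \<Longrightarrow> (g has_derivative g' y) (at y)"
    by (rule inverse_function_theorem[OF open_UNIV 1 2 UNIV_I 3]) blast
  define \<sigma> where "\<sigma> n = fst (g (0, n))" for n
  have Fg: "F (g y) = y" if "y \<in> V" for y using hom that by (simp add: homeomorphism_def)
  have gF: "g (F x) = x" "F x \<in> V" if "x \<in> U" for x using hom that by (auto simp: homeomorphism_def)
  have opn: "open {n. (0, n) \<in> V}"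
    using open_vimage[OF V, of "\<lambda>n. (0, n)"] by (simp add: vimage_def continuous_intros)
  have der: "(\<sigma> has_derivative (\<lambda>h. fst (g' (0, n) (0, h)))) (at n)" if "n \<in> {n. (0, n) \<in> V}" for n
  proof -
    have "((\<lambda>n. (0::real, n)) has_derivative (\<lambda>h. (0, h))) (at n)"
      by (intro has_derivative_Pair has_derivative_const has_derivative_ident)
    from has_derivative_compose[OF this g] that show ?thesis
      unfolding \<sigma>_def by (intro has_derivative_fst) simp
  qed
  have zer: "m (\<sigma> n) \<bullet> n = 0" if "n \<in> {n. (0, n) \<in> V}" for n
  proof -
    have "F (g (0, n)) = (0, n)" using Fg that by simp
    then have "(m (\<sigma> n) \<bullet> snd (g (0, n)), snd (g (0, n))) = (0, n)" by (simp only: F_def \<sigma>_def)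
    then show ?thesis by (metis prod.inject)
  qed
  have uni: "n \<in> {n. (0, n) \<in> V} \<and> \<sigma> n = s" if "(s, n) \<in> U" "m s \<bullet> n = 0" for s n
    using gF[OF that(1)] that(2) by (simp add: F_def \<sigma>_def)
  show ?thesis by (rule that[OF opn U der zer uni])
qed

lemma has_derivative_arctan_quotient:
  fixes p q :: "'a::real_normed_vector \<Rightarrow> real"
  assumes p: "(p has_derivative p') (at x)" and q: "(q has_derivative q') (at x)" and nz: "q x \<noteq> 0"
  shows "((\<lambda>x. arctan (p x / q x)) has_derivative
    (\<lambda>h. (p' h * q x - p x * q' h) / ((q x)\<^sup>2 + (p x)\<^sup>2))) (at x)"
proof -
  have "((\<lambda>x. arctan (p x / q x)) has_derivative
      (\<lambda>h. inverse (1 + (p x / q x)\<^sup>2) * ((p' h * q x - p x * q' h) / (q x * q x)))) (at x)"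
    by (rule has_derivative_compose[OF has_derivative_divide'[OF p q nz]
        DERIV_arctan[unfolded has_field_derivative_def]])
  moreover have "inverse (1 + (p x / q x)\<^sup>2) * (c / (q x * q x)) = c / ((q x)\<^sup>2 + (p x)\<^sup>2)" for c
  proof -
    have "(q x)\<^sup>2 + (p x)\<^sup>2 > 0" using nz by (simp add: add_pos_nonneg)
    then show ?thesis using nz
      by (simp add: divide_simps power2_eq_square add_eq_0_iff)
  qed
  ultimately show ?thesis by simp
qed

text \<open>
The control of an extremal as a function of its body momentum. It is the adjoint of
\<open>angular_velocity a\<close>, see \<open>inner_angular_velocity\<close>, and the Hamiltonian is half its squared norm.
\<close>
definition momentum_control :: "real \<Rightarrow> real^3 \<Rightarrow> real^2" where
  "momentum_control a m = vector [m $ 2, sqrt (1 - a\<^sup>2) * m $ 1]"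

lemma inner_angular_velocity: "m \<bullet> angular_velocity a v = momentum_control a m \<bullet> v"
  by (simp add: angular_velocity_def momentum_control_def inner_vec_def sum_3 sum_2 vector_3)

lemma bounded_linear_angular_velocity: "bounded_linear (angular_velocity a)"
  unfolding linear_conv_bounded_linear[symmetric]
  by (auto intro!: linearI simp: angular_velocity_def vec_eq_iff forall_3 vector_3 algebra_simps)

lemma bounded_linear_momentum_control: "bounded_linear (momentum_control a)"
  unfolding linear_conv_bounded_linear[symmetric]
  by (auto intro!: linearI simp: momentum_control_def vec_eq_iff forall_2 algebra_simps)

text \<open>
For \<open>y\<close> in the plane orthogonal to \<open>M\<close>, this is \<open>|M|\<close> times the rate at which the angle from \<open>e\<close> to
\<open>y\<close> changes when \<open>y\<close> moves with velocity \<open>v\<close>. The factor \<open>|M|\<close> is already contained in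
\<open>M \<times> e\<close>.
\<close>
definition planar_rate :: "real^3 \<Rightarrow> real^3 \<Rightarrow> real^3 \<Rightarrow> real^3 \<Rightarrow> real" where
  "planar_rate M e y v =
    ((y \<bullet> e) * (v \<bullet> (M \<times> e)) - (y \<bullet> (M \<times> e)) * (v \<bullet> e)) / ((e \<bullet> e) * (y \<bullet> y))"

lemma planar_rate_add_scaleR:
  "planar_rate M e y (c *\<^sub>R v + w) = c * planar_rate M e y v + planar_rate M e y w"
  by (simp add: planar_rate_def inner_add_left algebra_simps flip: add_divide_distrib)

lemma planar_rate_minus: "planar_rate M e y (- v) = - planar_rate M e y v"
proof -
  have "planar_rate M e y 0 = 0" by (simp add: planar_rate_def)
  then show ?thesis using planar_rate_add_scaleR[of M e y "-1" v 0] by simp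
qed

lemma planar_rate_rotation:
  assumes "e \<bullet> M = 0" "y \<bullet> M = 0" "e \<noteq> 0" "y \<noteq> 0"
  shows "planar_rate M e y (z \<times> y) = M \<bullet> z"
  using assms by (simp add: planar_rate_def planar_rate_identity)

lemma abs_planar_rate_le:
  assumes "e \<noteq> 0" "y \<noteq> 0"
  shows "\<bar>planar_rate M e y v\<bar> \<le> 2 * norm M / norm y * norm v"
proof -
  let ?c = "M \<times> e"
  have c: "norm ?c \<le> norm M * norm e" by (rule norm_cross_le)
  have "\<bar>(y \<bullet> e) * (v \<bullet> ?c) - (y \<bullet> ?c) * (v \<bullet> e)\<bar> \<le> \<bar>y \<bullet> e\<bar> * \<bar>v \<bullet> ?c\<bar> + \<bar>y \<bullet> ?c\<bar> * \<bar>v \<bullet> e\<bar>"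
    by (metis abs_mult abs_triangle_ineq4)
  also have "\<dots> \<le> (norm y * norm e) * (norm v * (norm M * norm e)) + (norm y * (norm M * norm e)) * (norm v * norm e)"
    by (intro add_mono mult_mono Cauchy_Schwarz_ineq2 order_trans[OF Cauchy_Schwarz_ineq2] c) auto
  also have "\<dots> = 2 * norm M / norm y * norm v * ((e \<bullet> e) * (y \<bullet> y))"
    using assms by (simp add: dot_square_norm power2_eq_square field_simps)
  finally show ?thesis
    using assms by (simp add: planar_rate_def divide_le_eq abs_divide abs_mult)
qed

lemma has_derivative_planar_angle:
  fixes y :: "'a::real_normed_vector \<Rightarrow> real^3"
  assumes y: "(y has_derivative y') (at n)" and e: "e \<bullet> M = 0" "M \<noteq> 0"
    and yn: "y n \<bullet> M = 0" "y n \<bullet> e \<noteq> 0"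
  shows "((\<lambda>n. norm M * arctan ((y n \<bullet> (M \<times> e)) / (norm M * (y n \<bullet> e)))) has_derivative
    (\<lambda>h. planar_rate M e (y n) (y' h))) (at n)"
proof -
  have d: "((\<lambda>n. norm M * arctan ((y n \<bullet> (M \<times> e)) / (norm M * (y n \<bullet> e)))) has_derivative
    (\<lambda>h. norm M * ((y' h \<bullet> (M \<times> e) * (norm M * (y n \<bullet> e)) - (y n \<bullet> (M \<times> e)) * (norm M * (y' h \<bullet> e)))
      / ((norm M * (y n \<bullet> e))\<^sup>2 + (y n \<bullet> (M \<times> e))\<^sup>2)))) (at n)"
    by (intro has_derivative_mult_right has_derivative_arctan_quotient has_derivative_inner_left y)
       (use e yn in auto)
  have den: "(norm M * (y n \<bullet> e))\<^sup>2 + (y n \<bullet> (M \<times> e))\<^sup>2 = (norm M)\<^sup>2 * ((e \<bullet> e) * (y n \<bullet> y n))"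
    using planar_norm_identity[OF e(1) yn(1)] by (simp add: dot_square_norm power_mult_distrib)
  show ?thesis
    by (rule has_derivative_eq_rhs[OF d], unfold den)
       (use e in \<open>simp add: planar_rate_def fun_eq_iff divide_simps power2_eq_square algebra_simps\<close>)
qed

text \<open>
Normal extremals parametrized by arclength, in momentum variables: \<open>m\<close> is \<open>(p\<^sub>2 / b, p\<^sub>1, p\<^sub>3 / b)\<close>
with \<open>b = sqrt (1 - a\<^sup>2)\<close>, so that \<open>momentum_control a m\<close> is \<open>(p\<^sub>1, p\<^sub>2)\<close>.
\<close>
locale extremal =
  fixes a :: real and R :: "real \<Rightarrow> real^3^3" and m :: "real \<Rightarrow> real^3"
  assumes a: "0 < a" "a < 1"
    and R_zero: "R 0 = mat 1"
    and R_deriv: "\<And>t. (R has_vector_derivative R t ** control_matrix a (momentum_control a (m t))) (at t)"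
    and m_deriv: "\<And>t. (m has_vector_derivative m t \<times> angular_velocity a (momentum_control a (m t))) (at t)"
    and unit_speed: "\<And>t. norm (momentum_control a (m t)) = 1"
begin

abbreviation "u t \<equiv> momentum_control a (m t)"
abbreviation "\<omega> t \<equiv> angular_velocity a (u t)"

lemma continuous_R: "continuous_on S R"
  by (meson R_deriv continuous_at_imp_continuous_on has_vector_derivative_continuous)

lemma continuous_m: "continuous_on S m"
  by (meson m_deriv continuous_at_imp_continuous_on has_vector_derivative_continuous)

lemma continuous_control: "continuous_on S (\<lambda>t. control_matrix a (u t))"
  unfolding control_matrix_def momentum_control_def vector_2
  by (intro continuous_intros continuous_m)

text \<open>
\<open>R R\<^sup>T\<close> is constant since the control matrices are skew, and the determinant, being \<open>1\<close> or \<open>-1\<close>, cannot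
jump.
\<close>
lemma R_SO3: "R t \<in> SO3"
proof -
  have "((\<lambda>t. R t ** transpose (R t)) has_vector_derivative 0) (at t)" for t
    by (auto intro!: derivative_eq_intros R_deriv simp: matrix_transpose_mul transpose_control_matrix
        matrix_mul_assoc[symmetric] bounded_bilinear.minus_left[OF bounded_bilinear_matrix_matrix]
        bounded_bilinear.minus_right[OF bounded_bilinear_matrix_matrix])
  then obtain c where c: "\<And>t. R t ** transpose (R t) = c"
    using has_vector_derivative_zero_constant[of UNIV "\<lambda>t. R t ** transpose (R t)"] by auto
  have "c = mat 1" using c[of 0] by (simp add: R_zero transpose_mat)
  with c have o: "orthogonal_matrix (R t)" for t
    by (metis orthogonal_matrix_def matrix_left_right_inverse)
  have "continuous_on UNIV (\<lambda>t. det (R t))"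
    unfolding det_3 by (intro continuous_intros continuous_R)
  moreover have "finite (range (\<lambda>t. det (R t)))"
    by (rule finite_subset[of _ "{1, -1}"]) (use det_orthogonal_matrix[OF o] in auto)
  ultimately have "(\<lambda>t. det (R t)) constant_on UNIV"
    by (intro continuous_finite_range_constant) auto
  then have "det (R t) = 1"
    using R_zero by (auto simp: constant_on_def) (metis det_I)
  with o show ?thesis by (simp add: SO3_def rotation_matrix_def)
qed

lemma momentum_conserved: "R t *v m t = m 0"
proof -
  have "((\<lambda>t. R t *v m t) has_vector_derivative 0) (at t)" for t
    by (auto intro!: derivative_eq_intros R_deriv m_deriv
        simp: control_matrix_mult_vec cross_skew[of "m t"] matrix_vector_mul_assoc[symmetric]
          bounded_bilinear.minus_right[OF bounded_bilinear_matrix_vector])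
  then obtain c where c: "\<And>t. R t *v m t = c"
    using has_vector_derivative_zero_constant[of UNIV "\<lambda>t. R t *v m t"] by auto
  from c[of t] c[of 0] show ?thesis by (simp add: R_zero)
qed

lemma horizontal_R: "horizontal a s t R u"
proof -
  have d: "(R has_derivative (\<lambda>h. h *\<^sub>R (R \<tau> ** control_matrix a (u \<tau>)))) (at \<tau> within S)" for \<tau> S
    using has_vector_derivative_at_within[OF R_deriv] by (simp add: has_vector_derivative_def)
  have "continuous_on {s..t} (\<lambda>\<tau>. R \<tau> ** control_matrix a (u \<tau>))"
    by (intro bounded_bilinear.continuous_on[OF bounded_bilinear_matrix_matrix] continuous_R continuous_control)
  from compact_imp_bounded[OF compact_continuous_image[OF this compact_Icc]]
  obtain B where B: "\<And>\<tau>. \<tau> \<in> {s..t} \<Longrightarrow> norm (R \<tau> ** control_matrix a (u \<tau>)) \<le> B"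
    unfolding bounded_iff by blast
  have "(max B 0)-lipschitz_on {s..t} R"
  proof (rule bounded_derivative_imp_lipschitz[OF d])
    fix \<tau> assume "\<tau> \<in> {s..t}"
    then have "norm (R \<tau> ** control_matrix a (u \<tau>)) \<le> max B 0" using B[of \<tau>] by linarith
    then show "onorm (\<lambda>h. h *\<^sub>R (R \<tau> ** control_matrix a (u \<tau>))) \<le> max B 0"
      by (intro onorm_bound) (auto simp: mult.commute mult_left_mono)
  qed auto
  then show ?thesis
    unfolding horizontal_def using R_SO3 has_vector_derivative_at_within[OF R_deriv]
    by (auto simp: control_matrix_def)
qed

text \<open>
The explicit local solution of the Hamilton--Jacobi equation: \<open>f n = \<sigma> n - |M| \<beta>\<close> with \<open>\<sigma> n\<close>
the time near \<open>\<tau>\<close> at which the momentum is orthogonal to \<open>n\<close>, and \<open>\<beta>\<close> the angle from \<open>e\<close> to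
\<open>y n = R (\<sigma> n) n\<close> in the plane orthogonal to \<open>M\<close>. The momentum has to move at time \<open>\<tau>\<close> for \<open>\<sigma>\<close> to be
defined by the implicit function theorem.
\<close>
lemma calibration:
  assumes regular: "m \<tau> \<times> \<omega> \<tau> \<noteq> 0"
  obtains f f' e n0 r B \<eta> where "0 < r" "0 < \<eta>" "e \<noteq> 0"
    "\<And>n. n \<in> ball n0 r \<Longrightarrow> (f has_derivative f' n) (at n)"
    "\<And>n w. n \<in> ball n0 r \<Longrightarrow> \<bar>f' n w\<bar> \<le> B * norm w"
    "\<And>n v. n \<in> ball n0 r \<Longrightarrow> f' n (- (angular_velocity a v \<times> n)) \<le> norm v"
    "\<And>s. \<bar>s - \<tau>\<bar> < \<eta> \<Longrightarrow> transpose (R s) *v e \<in> ball n0 (r / 2)"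
    "\<And>s. \<bar>s - \<tau>\<bar> < \<eta> \<Longrightarrow> f (transpose (R s) *v e) = s"
proof -
  \<comment> \<open>The velocity of the momentum at time \<open>\<tau>\<close>: it is orthogonal to \<open>m \<tau>\<close>, and the choice makes the
    crossing of \<open>m s \<bullet> n0\<close> through zero at \<open>s = \<tau>\<close> transversal.\<close>
  define n0 where "n0 = m \<tau> \<times> \<omega> \<tau>"
  define e where "e = R \<tau> *v n0"
  define M where "M = m 0"
  have n0: "n0 \<noteq> 0" using regular by (simp add: n0_def)
  have ne: "norm e = norm n0" by (simp add: e_def in_SO3D(4)[OF R_SO3])
  then have e0: "e \<noteq> 0" using n0 by auto
  have M_inner: "(R s *v n) \<bullet> M = n \<bullet> m s" for s n
    unfolding M_def momentum_conserved[of s, symmetric] by (rule in_SO3D(3)[OF R_SO3])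
  have eM: "e \<bullet> M = 0" unfolding e_def M_inner by (simp add: n0_def dot_cross_self)
  have M0: "M \<noteq> 0"
  proof
    assume "M = 0"
    then have "norm (m \<tau>) = 0" using momentum_conserved[of \<tau>] in_SO3D(4)[OF R_SO3, of \<tau> "m \<tau>"] by (simp add: M_def)
    then show False using regular by simp
  qed
  have "continuous_on UNIV (\<lambda>t. m t \<times> \<omega> t)"
    by (intro continuous_on_cross continuous_m bounded_linear.continuous_on[OF bounded_linear_angular_velocity]
        bounded_linear.continuous_on[OF bounded_linear_momentum_control])
  moreover have "m \<tau> \<bullet> n0 = 0" "(m \<tau> \<times> \<omega> \<tau>) \<bullet> n0 \<noteq> 0"
    using n0 by (auto simp: n0_def dot_cross_self)
  ultimately obtain \<sigma> \<sigma>' V W where V: "open V" and W: "open W" "(\<tau>, n0) \<in> W"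
    and \<sigma>': "\<And>n. n \<in> V \<Longrightarrow> (\<sigma> has_derivative \<sigma>' n) (at n)"
    and \<sigma>: "\<And>n. n \<in> V \<Longrightarrow> m (\<sigma> n) \<bullet> n = 0"
    and unique: "\<And>s n. (s, n) \<in> W \<Longrightarrow> m s \<bullet> n = 0 \<Longrightarrow> n \<in> V \<and> \<sigma> n = s"
    by (rule implicit_time[OF m_deriv, of \<tau> n0]) blast
  have \<sigma>_n0: "n0 \<in> V" "\<sigma> n0 = \<tau>" using unique[OF W(2)] \<open>m \<tau> \<bullet> n0 = 0\<close> by auto
  define y where "y n = R (\<sigma> n) *v n" for n
  define f where "f n = \<sigma> n - norm M * arctan ((y n \<bullet> (M \<times> e)) / (norm M * (y n \<bullet> e)))" for n
  define f' where "f' n w = - planar_rate M e (y n) (R (\<sigma> n) *v w)" for n w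
  have y_deriv: "(y has_derivative (\<lambda>h. \<sigma>' n h *\<^sub>R ((R (\<sigma> n) *v \<omega> (\<sigma> n)) \<times> y n) + R (\<sigma> n) *v h)) (at n)"
    if n: "n \<in> V" for n
  proof -
    have "((\<lambda>n. R (\<sigma> n)) has_derivative (\<lambda>h. \<sigma>' n h *\<^sub>R (R (\<sigma> n) ** control_matrix a (u (\<sigma> n))))) (at n)"
      by (rule has_derivative_compose[OF \<sigma>'[OF n] R_deriv[unfolded has_vector_derivative_def]])
    from bounded_bilinear.FDERIV[OF bounded_bilinear_matrix_vector this has_derivative_ident]
    show ?thesis unfolding y_def
      by (rule has_derivative_eq_rhs)
        (simp add: fun_eq_iff in_SO3D(6)[OF R_SO3] control_matrix_mult_vec[symmetric]
          matrix_vector_mul_assoc scaleR_matrix_vector_assoc add.commute)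
  qed
  have yM: "y n \<bullet> M = 0" if "n \<in> V" for n
    using \<sigma>[OF that] M_inner[of "\<sigma> n" n] by (simp add: y_def inner_commute[of n])
  have norm_y: "norm (y n) = norm n" for n by (simp add: y_def in_SO3D(4)[OF R_SO3])
  have rate: "planar_rate M e (y n) ((R (\<sigma> n) *v z) \<times> y n) = m (\<sigma> n) \<bullet> z" if "n \<in> V" "n \<noteq> 0" for n z
  proof -
    have "y n \<noteq> 0" using norm_y[of n] that by auto
    then show ?thesis
      using planar_rate_rotation[OF eM yM[OF that(1)] e0] M_inner[of "\<sigma> n" z]
      by (simp add: inner_commute[of M] inner_commute[of z])
  qed
  have f_deriv: "(f has_derivative f' n) (at n)" if n: "n \<in> V" "n \<noteq> 0" "y n \<bullet> e \<noteq> 0" for n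
  proof -
    \<comment> \<open>Unit speed makes the contributions of the moving time \<open>\<sigma> n\<close> cancel, which leaves \<open>f'\<close>.\<close>
    have "m (\<sigma> n) \<bullet> \<omega> (\<sigma> n) = 1"
      using unit_speed by (simp add: inner_angular_velocity dot_square_norm)
    then have one: "planar_rate M e (y n) ((R (\<sigma> n) *v \<omega> (\<sigma> n)) \<times> y n) = 1"
      using rate[OF n(1,2)] by simp
    show ?thesis
      unfolding f_def
      by (rule has_derivative_eq_rhs[OF has_derivative_diff[OF \<sigma>'[OF n(1)]
            has_derivative_planar_angle[OF y_deriv[OF n(1)] eM M0 yM[OF n(1)] n(3)]]])
        (simp add: fun_eq_iff f'_def planar_rate_add_scaleR one)
  qed
  define G where "G = {n \<in> V. 0 < y n \<bullet> e}"
  have conty: "continuous_on V y"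
    using y_deriv by (meson continuous_at_imp_continuous_on has_derivative_continuous)
  have "open (V \<inter> (\<lambda>n. y n \<bullet> e) -` {0<..})"
    by (rule continuous_open_preimage[OF _ V]) (auto intro!: continuous_intros conty)
  also have "V \<inter> (\<lambda>n. y n \<bullet> e) -` {0<..} = G" by (auto simp: G_def)
  finally have "open G" .
  moreover have "n0 \<in> G" using \<sigma>_n0 e0 by (simp add: G_def y_def e_def[symmetric])
  ultimately obtain r0 where r0: "r0 > 0" "ball n0 r0 \<subseteq> G" by (meson open_contains_ball)
  define r where "r = min r0 (norm n0 / 2)"
  have r: "r > 0" using r0 n0 by (simp add: r_def)
  have ballD: "n \<in> V" "0 < y n \<bullet> e" "norm n0 / 2 \<le> norm n" "n \<noteq> 0" if "n \<in> ball n0 r" for n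
  proof -
    have "n \<in> G" using that r0 by (auto simp: r_def)
    then show "n \<in> V" "0 < y n \<bullet> e" by (auto simp: G_def)
    show "norm n0 / 2 \<le> norm n" 
      using that norm_triangle_ineq2[of n0 n] by (auto simp: r_def dist_norm)
    then show "n \<noteq> 0" using n0 by auto
  qed
  have bound: "\<bar>f' n w\<bar> \<le> 4 * norm M / norm n0 * norm w" if n: "n \<in> ball n0 r" for n w
  proof -
    have "y n \<noteq> 0" using ballD(4)[OF n] norm_y[of n] by auto
    then have "\<bar>f' n w\<bar> \<le> 2 * norm M / norm n * norm w"
      using abs_planar_rate_le[OF e0, of "y n" M "R (\<sigma> n) *v w"]
      by (simp add: f'_def norm_y in_SO3D(4)[OF R_SO3])
    also have "\<dots> \<le> 2 * norm M / (norm n0 / 2) * norm w"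
      by (intro mult_right_mono divide_left_mono ballD(3)[OF n]) (use ballD(4)[OF n] n0 in auto)
    finally show ?thesis by simp
  qed
  have eikonal: "f' n (- (angular_velocity a v \<times> n)) \<le> norm v" if n: "n \<in> ball n0 r" for n v
  proof -
    have "f' n (- (angular_velocity a v \<times> n)) = planar_rate M e (y n) (R (\<sigma> n) *v (angular_velocity a v \<times> n))"
      by (simp add: f'_def planar_rate_minus bounded_bilinear.minus_right[OF bounded_bilinear_matrix_vector])
    also have "\<dots> = m (\<sigma> n) \<bullet> angular_velocity a v"
      using rate[OF ballD(1,4)[OF n]] by (simp add: y_def in_SO3D(6)[OF R_SO3])
    also have "\<dots> = u (\<sigma> n) \<bullet> v" by (rule inner_angular_velocity)
    also have "\<dots> \<le> norm v" using norm_cauchy_schwarz[of "u (\<sigma> n)" v] by (simp add: unit_speed)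
    finally show ?thesis .
  qed
  let ?n = "\<lambda>s. transpose (R s) *v e"
  have contn: "continuous_on UNIV ?n"
    by (intro bounded_bilinear.continuous_on[OF bounded_bilinear_matrix_vector]
        bounded_linear.continuous_on[OF bounded_linear_transpose] continuous_R continuous_on_const)
  have n\<tau>: "?n \<tau> = n0" by (simp add: e_def in_SO3D(8)[OF R_SO3])
  have "open ((\<lambda>s. (s, ?n s)) -` (W \<inter> snd -` ball n0 (r / 2)))"
    by (intro open_vimage open_vimage_snd open_Int W open_ball continuous_intros contn)
  moreover have "\<tau> \<in> (\<lambda>s. (s, ?n s)) -` (W \<inter> snd -` ball n0 (r / 2))"
    using W r by (simp add: n\<tau>)
  ultimately obtain \<eta> where \<eta>: "\<eta> > 0" "ball \<tau> \<eta> \<subseteq> (\<lambda>s. (s, ?n s)) -` (W \<inter> snd -` ball n0 (r / 2))"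
    by (meson open_contains_ball)
  have near: "(s, ?n s) \<in> W" "?n s \<in> ball n0 (r / 2)" if "\<bar>s - \<tau>\<bar> < \<eta>" for s
    using \<eta>(2) that by (auto simp: subset_eq dist_real_def abs_minus_commute)
  have time: "f (?n s) = s" if "\<bar>s - \<tau>\<bar> < \<eta>" for s
  proof -
    \<comment> \<open>On the extremal itself the angle vanishes and \<open>\<sigma>\<close> is the time.\<close>
    have Re: "R s *v ?n s = e" by (rule in_SO3D(7)[OF R_SO3])
    have "m s \<bullet> ?n s = 0"
      using M_inner[of s "?n s"] by (simp add: Re eM inner_commute[of "m s"])
    then have "\<sigma> (?n s) = s" using unique[OF near(1)[OF that]] by simp
    then show ?thesis by (simp add: f_def y_def Re dot_cross_self)
  qed
  have f_deriv_ball: "(f has_derivative f' n) (at n)" if "n \<in> ball n0 r" for n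
    using ballD[OF that] by (intro f_deriv) simp_all
  show ?thesis
    by (rule that[OF r \<eta>(1) e0 f_deriv_ball bound eikonal near(2) time])
qed

theorem geodesic_R:
  assumes regular: "\<And>t. m t \<times> \<omega> t \<noteq> 0"
  shows "geodesic a R"
  unfolding geodesic_def
proof (intro conjI exI[of _ u] allI impI)
  show "R 0 = mat 1" by (rule R_zero)
  show "horizontal a s t R u" for s t by (rule horizontal_R)
  show "AE \<tau> in lebesgue. norm (u \<tau>) = 1" by (simp add: unit_speed)
  fix \<tau> :: real
  obtain f f' e n0 r B \<eta> where r: "0 < r" and \<eta>: "0 < \<eta>" and e: "e \<noteq> 0"
    and f: "\<And>n. n \<in> ball n0 r \<Longrightarrow> (f has_derivative f' n) (at n)"
    and B: "\<And>n w. n \<in> ball n0 r \<Longrightarrow> \<bar>f' n w\<bar> \<le> B * norm w"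
    and eikonal: "\<And>n v. n \<in> ball n0 r \<Longrightarrow> f' n (- (angular_velocity a v \<times> n)) \<le> norm v"
    and near: "\<And>s. \<bar>s - \<tau>\<bar> < \<eta> \<Longrightarrow> transpose (R s) *v e \<in> ball n0 (r / 2)"
    and time: "\<And>s. \<bar>s - \<tau>\<bar> < \<eta> \<Longrightarrow> f (transpose (R s) *v e) = s"
    by (rule calibration[OF regular[of \<tau>]]) blast
  \<comment> \<open>Arcs shorter than \<open>r / (2 |e|)\<close> cannot be undercut by curves leaving the domain of \<open>f\<close>.\<close>
  define \<epsilon> where "\<epsilon> = min \<eta> (r / (4 * norm e))"
  have \<epsilon>: "\<epsilon> > 0" using r \<eta> e by (simp add: \<epsilon>_def)
  have "length_minimizer a s t R u" if st: "\<tau> - \<epsilon> < s \<and> s < t \<and> t < \<tau> + \<epsilon>" for s t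
    unfolding length_minimizer_def
  proof (intro conjI allI impI)
    show "horizontal a s t R u" by (rule horizontal_R)
    fix Q v assume Q: "horizontal a s t Q v \<and> Q s = R s \<and> Q t = R t"
    have s: "\<bar>s - \<tau>\<bar> < \<eta>" and t: "\<bar>t - \<tau>\<bar> < \<eta>" using st by (auto simp: \<epsilon>_def)
    have "2 * \<epsilon> \<le> r / (2 * norm e)" by (simp add: \<epsilon>_def min_def field_simps)
    with st have short: "t - s \<le> r / (2 * norm e)" by linarith
    have hor: "horizontal a s t Q v" and ends: "Q s = R s" "Q t = R t" and le: "s \<le> t"
      using Q st by auto
    have start: "transpose (Q s) *v e \<in> ball n0 (r / 2)" using near[OF s] by (simp only: ends)
    have diff: "f (transpose (Q t) *v e) - f (transpose (Q s) *v e) = t - s"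
      using time[OF s] time[OF t] by (simp only: ends)
    have "t - s \<le> sr_length s t v"
      using calibrated_length_le[OF hor le a start e f B eikonal] short unfolding diff by blast
    then show "sr_length s t u \<le> sr_length s t v"
      using st by (simp add: sr_length_def unit_speed)
  qed
  with \<epsilon> show "\<exists>\<epsilon>>0. \<forall>s t. \<tau> - \<epsilon> < s \<and> s < t \<and> t < \<tau> + \<epsilon> \<longrightarrow> length_minimizer a s t R u" by blast
qed

end

section \<open>Periodic flows and moving frames\<close>

lemma periodic_antiderivative:
  fixes g :: "real \<Rightarrow> real"
  assumes cont: "continuous_on UNIV g" and per: "\<And>x. g (x + p) = g x" and p: "0 \<le> p"
  obtains G where "G 0 = 0" "\<And>x. (G has_real_derivative g x) (at x)"
    "\<And>x. G (x + p) = G x + integral {0..p} g"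
proof -
  have "isCont g x" for x using cont by (simp add: continuous_on_eq_continuous_at)
  then obtain H where "\<And>x. (H has_vector_derivative g x) (at x)"
    using einterval_antiderivative[of "-\<infinity>" \<infinity> g] by auto
  then have H: "(H has_real_derivative g x) (at x)" for x
    by (simp add: has_real_derivative_iff_has_vector_derivative)
  define G where "G x = H x - H 0" for x
  have G: "(G has_real_derivative g x) (at x)" for x
    unfolding G_def by (auto intro!: derivative_eq_intros H)
  have shift: "((\<lambda>x. G (x + p)) has_real_derivative g x) (at x)" for x
    using G[of "x + p"] by (simp add: DERIV_shift per)
  have "((\<lambda>x. G (x + p) - G x) has_real_derivative 0) (at x)" for x
    by (auto intro!: derivative_eq_intros shift G)
  then have "G (x + p) - G x = G (0 + p) - G 0" for x
    by (intro DERIV_isconst_all) blast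
  then have diff: "G (x + p) - G x = G p - G 0" for x by simp
  have "(g has_integral (G p - G 0)) {0..p}"
    by (intro fundamental_theorem_of_calculus p)
       (auto simp: has_real_derivative_iff_has_vector_derivative[symmetric] intro: DERIV_subset[OF G])
  then have shift_G: "G (x + p) = G x + integral {0..p} g" for x
    using diff[of x] by (simp add: integral_unique)
  show ?thesis by (rule that[OF _ G shift_G]) (simp add: G_def)
qed

lemma shift_iterate:
  fixes F :: "real \<Rightarrow> real"
  assumes "\<And>x. F (x + p) = F x + c"
  shows "F (x + real n * p) = F x + real n * c"
proof (induction n)
  case (Suc n)
  show ?case using Suc assms[of "x + real n * p"] by (simp add: algebra_simps)
qed simp

text \<open>
A scalar autonomous equation with positive periodic speed is solved by inverting the travel time
\<open>T\<close>, a primitive of \<open>1 / w\<close>. Since \<open>T\<close> grows by a fixed \<open>P > 0\<close> over each period of \<open>w\<close>, it is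
onto, so the solution exists for all times.
\<close>
lemma periodic_flow:
  fixes w :: "real \<Rightarrow> real"
  assumes cont: "continuous_on UNIV w" and pos: "\<And>x. 0 < w x" and per: "\<And>x. w (x + p) = w x" and p: "0 < p"
  obtains \<theta> P where "0 < P" "\<And>t. (\<theta> has_real_derivative w (\<theta> t)) (at t)"
    "\<And>t. \<theta> (t + P) = \<theta> t + p" "surj \<theta>"
proof -
  have "continuous_on UNIV (\<lambda>x. 1 / w x)"
    using pos by (intro continuous_intros cont) (metis less_irrefl)
  moreover have "1 / w (x + p) = 1 / w x" for x by (simp add: per)
  ultimately obtain T where T0: "T 0 = 0" and T: "\<And>x. (T has_real_derivative 1 / w x) (at x)"
    and TP: "\<And>x. T (x + p) = T x + integral {0..p} (\<lambda>x. 1 / w x)"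
    by (rule periodic_antiderivative[OF _ _ less_imp_le[OF p]]) blast
  define P where "P = integral {0..p} (\<lambda>x. 1 / w x)"
  note TP = TP[folded P_def]
  have mono: "T x < T y" if "x < y" for x y
    by (rule DERIV_pos_imp_increasing[OF that]) (use T pos in \<open>metis zero_less_divide_1_iff\<close>)
  have P: "P > 0" using mono[OF p] TP[of 0] T0 by simp
  have contT: "isCont T x" for x using T DERIV_isCont by blast
  have "\<exists>x. T x = y" for y
  proof -
    obtain n where n: "\<bar>y\<bar> \<le> real n * P"
      using reals_Archimedean3[OF P] less_imp_le by blast
    have "T (0 + real n * p) = real n * P" using shift_iterate[where F=T and p=p and c=P and x=0 and n=n, OF TP] T0 by simp
    moreover have "T (- (real n * p) + real n * p) = T (- (real n * p)) + real n * P"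
      by (rule shift_iterate[where F=T and p=p and c=P, OF TP])
    ultimately have "T (- (real n * p)) \<le> y" "y \<le> T (real n * p)" using n T0 by auto
    moreover have "- (real n * p) \<le> real n * p" using p by simp
    ultimately show ?thesis using IVT[of T "- (real n * p)" y "real n * p"] contT by blast
  qed
  then obtain \<theta> where \<theta>: "\<And>y. T (\<theta> y) = y" by metis
  have inj: "x = y" if "T x = T y" for x y using mono[of x y] mono[of y x] that by (cases x y rule: linorder_cases) auto
  have \<theta>T: "\<theta> (T x) = x" for x by (rule inj) (rule \<theta>)
  have "isCont \<theta> (T x)" for x
    by (rule isCont_inverse_function[where d=1]) (auto simp: \<theta>T contT)
  then have cont\<theta>: "isCont \<theta> y" for y by (metis \<theta>)
  have "(\<theta> has_real_derivative inverse (1 / w (\<theta> t))) (at t)" for t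
    by (rule DERIV_inverse_function[where a="t - 1" and b="t + 1", OF T])
       (use pos[of "\<theta> t"] in \<open>auto simp: \<theta> cont\<theta>\<close>)
  then have 1: "(\<theta> has_real_derivative w (\<theta> t)) (at t)" for t by simp
  have 2: "\<theta> (t + P) = \<theta> t + p" for t by (rule inj) (simp add: \<theta> TP)
  show ?thesis by (rule that[OF P 1 2]) (metis \<theta>T surjI)
qed

lemma has_vector_derivative_vector3:
  fixes f1 f2 f3 :: "real \<Rightarrow> 'a::euclidean_space"
  assumes "(f1 has_vector_derivative d1) F" "(f2 has_vector_derivative d2) F" "(f3 has_vector_derivative d3) F"
  shows "((\<lambda>t. vector [f1 t, f2 t, f3 t] :: 'a^3) has_vector_derivative vector [d1, d2, d3]) F"
proof -
  define L :: "3 \<Rightarrow> 'a \<Rightarrow> 'a^3" where "L i x = (\<chi> j. if j = i then x else 0)" for i x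
  have L: "bounded_linear (L i)" for i
    unfolding L_def linear_conv_bounded_linear[symmetric] by (auto intro!: linearI simp: vec_eq_iff)
  have split: "vector [x, y, z] = L 1 x + L 2 y + L 3 z" for x y z
    by (simp add: L_def vec_eq_iff forall_3 vector_3)
  show ?thesis
    unfolding split by (intro has_vector_derivative_add bounded_linear.has_vector_derivative[OF L] assms)
qed

lemma orthogonal_matrix_cross_frame:
  fixes y n :: "real^3"
  assumes "y \<bullet> y = 1" "n \<bullet> n = 1" "y \<bullet> n = 0"
  shows "orthogonal_matrix (vector [y, n \<times> y, n] :: real^3^3)"
proof -
  have "(n \<times> y) \<bullet> (n \<times> y) = 1"
    using norm_cross_dot[of n y] assms by (simp add: dot_square_norm power_mult_distrib inner_commute)
  then have "(vector [y, n \<times> y, n] :: real^3^3) ** transpose (vector [y, n \<times> y, n]) = mat 1"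
    using assms by (simp add: vec_eq_iff forall_3 matrix_matrix_mult_def transpose_def mat_def vector_3
        inner_vec_def sum_3 cross3_def algebra_simps)
  then show ?thesis by (simp add: orthogonal_matrix_def matrix_left_right_inverse)
qed

text \<open>
Vectors fixed in space satisfy \<open>y' = y \<times> \<omega>\<close> in the body frame. By the Jacobi identity the cross
product of two solutions is a third one, and solutions are what the rows of a matrix with
\<open>F' = F K\<close> have to be.
\<close>
lemma frame_derivative:
  fixes y n :: "real \<Rightarrow> real^3"
  assumes y: "(y has_vector_derivative y t \<times> angular_velocity a v) (at t)"
    and n: "(n has_vector_derivative n t \<times> angular_velocity a v) (at t)"
  shows "((\<lambda>t. vector [y t, n t \<times> y t, n t] :: real^3^3) has_vector_derivative
    vector [y t, n t \<times> y t, n t] ** control_matrix a v) (at t)"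
proof -
  let ?\<omega> = "angular_velocity a v"
  have "((\<lambda>t. n t \<times> y t) has_vector_derivative n t \<times> (y t \<times> ?\<omega>) + (n t \<times> ?\<omega>) \<times> y t) (at t)"
    by (rule has_vector_derivative_cross[OF n y])
  also have "n t \<times> (y t \<times> ?\<omega>) + (n t \<times> ?\<omega>) \<times> y t = (n t \<times> y t) \<times> ?\<omega>"
    by (simp add: cross3_simps forall_3)
  finally have ny: "((\<lambda>t. n t \<times> y t) has_vector_derivative (n t \<times> y t) \<times> ?\<omega>) (at t)" .
  have "vector [y t \<times> ?\<omega>, (n t \<times> y t) \<times> ?\<omega>, n t \<times> ?\<omega>]
      = (vector [y t, n t \<times> y t, n t] :: real^3^3) ** control_matrix a v"
    by (simp add: vec_eq_iff forall_3 matrix_matrix_mult_def vector_3 sum_3 cross3_def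
        control_matrix_def angular_velocity_def X1_def X2_def A1_def A2_def)
  then show ?thesis using has_vector_derivative_vector3[OF y ny n] by simp
qed

text \<open>
Given the momentum \<open>m\<close> as one solution of \<open>y' = y \<times> \<omega>\<close>, any explicit moving vector \<open>g\<close> orthogonal
to \<open>m\<close> produces a second one. The defect \<open>g' - g \<times> \<omega>\<close> has a component \<open>\<alpha> g\<close>, which is removed by
the scaling \<open>r\<close>, and a component \<open>\<beta> (m \<times> g)\<close>, which is removed by turning \<open>g\<close> backwards about
\<open>m\<close> through the angle \<open>\<phi>\<close> with \<open>\<phi>' = \<beta> |m|\<close>.
\<close>
lemma rotating_vector_derivative:
  fixes m g :: "real \<Rightarrow> real^3" and r \<phi> :: "real \<Rightarrow> real"
  assumes m: "(m has_vector_derivative m t \<times> \<omega>) (at t)"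
    and g: "(g has_vector_derivative g t \<times> \<omega> + \<alpha> *\<^sub>R g t + \<beta> *\<^sub>R (m t \<times> g t)) (at t)"
    and r: "(r has_real_derivative - \<alpha> * r t) (at t)"
    and \<phi>: "(\<phi> has_real_derivative \<beta> * \<mu>) (at t)"
    and \<mu>: "m t \<bullet> m t = \<mu>\<^sup>2" "\<mu> \<noteq> 0" and perp: "m t \<bullet> g t = 0"
  defines "y \<equiv> \<lambda>t. (r t * cos (\<phi> t)) *\<^sub>R g t - (r t * sin (\<phi> t) / \<mu>) *\<^sub>R (m t \<times> g t)"
  shows "(y has_vector_derivative y t \<times> \<omega>) (at t)"
proof -
  have "((\<lambda>t. m t \<times> g t) has_vector_derivative
      m t \<times> (g t \<times> \<omega> + \<alpha> *\<^sub>R g t + \<beta> *\<^sub>R (m t \<times> g t)) + (m t \<times> \<omega>) \<times> g t) (at t)"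
    by (rule has_vector_derivative_cross[OF m g])
  moreover have "m t \<times> (g t \<times> \<omega> + \<alpha> *\<^sub>R g t + \<beta> *\<^sub>R (m t \<times> g t)) + (m t \<times> \<omega>) \<times> g t
      = (m t \<times> g t) \<times> \<omega> + \<alpha> *\<^sub>R (m t \<times> g t) + \<beta> *\<^sub>R ((m t \<bullet> g t) *\<^sub>R m t - (m t \<bullet> m t) *\<^sub>R g t)"
    by (simp add: cross3_simps forall_3)
  ultimately have g2: "((\<lambda>t. m t \<times> g t) has_vector_derivative
      (m t \<times> g t) \<times> \<omega> + \<alpha> *\<^sub>R (m t \<times> g t) - (\<beta> * \<mu>\<^sup>2) *\<^sub>R g t) (at t)"
    by (simp add: perp \<mu>)
  have 1: "((\<lambda>t. r t * cos (\<phi> t)) has_real_derivative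
      - \<alpha> * (r t * cos (\<phi> t)) - \<beta> * \<mu> * (r t * sin (\<phi> t))) (at t)"
    by (auto intro!: derivative_eq_intros r \<phi>)
  have 2: "((\<lambda>t. r t * sin (\<phi> t) / \<mu>) has_real_derivative
      - \<alpha> * (r t * sin (\<phi> t) / \<mu>) + \<beta> * (r t * cos (\<phi> t))) (at t)"
    using \<mu>(2) by (auto intro!: derivative_eq_intros r \<phi> simp: field_simps)
  have *: "(y has_vector_derivative
      ((r t * cos (\<phi> t)) *\<^sub>R (g t \<times> \<omega> + \<alpha> *\<^sub>R g t + \<beta> *\<^sub>R (m t \<times> g t))
        + (- \<alpha> * (r t * cos (\<phi> t)) - \<beta> * \<mu> * (r t * sin (\<phi> t))) *\<^sub>R g t)
      - ((r t * sin (\<phi> t) / \<mu>) *\<^sub>R ((m t \<times> g t) \<times> \<omega> + \<alpha> *\<^sub>R (m t \<times> g t) - (\<beta> * \<mu>\<^sup>2) *\<^sub>R g t)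
        + (- \<alpha> * (r t * sin (\<phi> t) / \<mu>) + \<beta> * (r t * cos (\<phi> t))) *\<^sub>R (m t \<times> g t))) (at t)"
    unfolding y_def by (intro has_vector_derivative_diff has_vector_derivative_scaleR 1 2 g g2)
  have yo: "y t \<times> \<omega> = (r t * cos (\<phi> t)) *\<^sub>R (g t \<times> \<omega>) - (r t * sin (\<phi> t) / \<mu>) *\<^sub>R ((m t \<times> g t) \<times> \<omega>)"
    by (simp add: y_def Cross3.left_diff_distrib cross_mult_left)
  show ?thesis
    by (rule has_vector_derivative_eq_rhs[OF *]) (use \<mu>(2) in \<open>simp add: yo algebra_simps power2_eq_square\<close>)
qed

section \<open>An extremal that closes up\<close>

text \<open>
The curve \<open>momentum_at a C\<close> runs through the intersection of the energy cylinder \<open>m\<^sub>2\<^sup>2 + b\<^sup>2 m\<^sub>1\<^sup>2 = 1\<close> with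
the momentum sphere of radius \<open>sqrt (1 + C) / b\<close>, on the component where \<open>m\<^sub>3 < 0\<close>; the angle
\<open>\<theta>\<close> moves along it with velocity \<open>angle_speed a C \<theta>\<close>. The rate at which the frame turns about
the fixed momentum axis, per unit of \<open>\<theta>\<close>, is \<open>precession_rate a C \<theta>\<close>.
\<close>
definition angle_speed :: "real \<Rightarrow> real \<Rightarrow> real \<Rightarrow> real" where
  "angle_speed a C \<theta> = sqrt (C + a\<^sup>2 * (cos \<theta>)\<^sup>2)"

definition momentum_at :: "real \<Rightarrow> real \<Rightarrow> real \<Rightarrow> real^3" where
  "momentum_at a C \<theta> =
    vector [sin \<theta> / sqrt (1 - a\<^sup>2), cos \<theta>, - angle_speed a C \<theta> / sqrt (1 - a\<^sup>2)]"

definition precession_rate :: "real \<Rightarrow> real \<Rightarrow> real \<Rightarrow> real" where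
  "precession_rate a C \<theta> =
    sqrt (1 - a\<^sup>2) * sqrt (1 + C) * (cos \<theta>)\<^sup>2 / ((C + (cos \<theta>)\<^sup>2) * angle_speed a C \<theta>)"

lemma sqrt_one_minus_square:
  assumes "0 < (a::real)" "a < 1"
  shows "0 < sqrt (1 - a\<^sup>2)" "sqrt (1 - a\<^sup>2) \<le> 1" "(sqrt (1 - a\<^sup>2))\<^sup>2 = 1 - a\<^sup>2"
proof -
  have "a\<^sup>2 < 1" using assms by (simp add: power_less_one_iff)
  then show "0 < sqrt (1 - a\<^sup>2)" "sqrt (1 - a\<^sup>2) \<le> 1" "(sqrt (1 - a\<^sup>2))\<^sup>2 = 1 - a\<^sup>2" by simp_all
qed

lemma angle_speed_pos: "0 < C \<Longrightarrow> 0 < angle_speed a C \<theta>"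
  by (simp add: angle_speed_def add_pos_nonneg)

lemma continuous_angle_speed: "continuous_on S (angle_speed a C)"
  unfolding angle_speed_def by (intro continuous_intros)

lemma continuous_precession_rate: "0 < C \<Longrightarrow> continuous_on S (precession_rate a C)"
  unfolding precession_rate_def
  by (intro continuous_intros continuous_angle_speed) (simp add: angle_speed_pos less_imp_neq[symmetric] add_pos_nonneg)

text \<open>
The total precession \<open>\<Phi> C\<close> over one turn is positive at \<open>C = 1\<close>, at most \<open>4 \<pi> / C\<close> for
\<open>C \<ge> 1\<close>, and continuous. Once \<open>N\<close> is so large that \<open>2 \<pi> / N < \<Phi> 1\<close>, the intermediate value
theorem on \<open>[1, 2 N]\<close> gives \<open>\<Phi> C = 2 \<pi> / N\<close>.
\<close>
lemma exists_rational_precession: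
  assumes a: "0 < a" "a < 1"
  obtains C :: real and N :: nat where "0 < C" "0 < N"
    "integral {0..2*pi} (precession_rate a C) = 2 * pi / N"
proof -
  define b where "b = sqrt (1 - a\<^sup>2)"
  have b: "0 < b" "b \<le> 1" using sqrt_one_minus_square[OF a] by (simp_all add: b_def)
  define \<Phi> where "\<Phi> C = integral {0..2*pi} (precession_rate a C)" for C
  have nonneg: "0 \<le> precession_rate a C \<theta>" if "0 < C" for C \<theta>
    unfolding precession_rate_def b_def[symmetric]
    using b that angle_speed_pos[OF that, of a \<theta>] by (intro divide_nonneg_nonneg mult_nonneg_nonneg) auto
  have int: "precession_rate a C integrable_on {0..2*pi}" if "0 < C" for C
    by (intro integrable_continuous_interval continuous_precession_rate that)
  have "\<Phi> 1 \<noteq> 0"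
  proof -
    have "precession_rate a 1 0 \<noteq> 0"
      using b angle_speed_pos[of 1 a 0] by (simp add: precession_rate_def b_def)
    moreover have "(0::real) \<in> {0..2*pi}" by simp
    ultimately show ?thesis
      unfolding \<Phi>_def
      by (subst integral_eq_0_iff) (auto simp: continuous_precession_rate nonneg)
  qed
  moreover have "\<Phi> 1 \<ge> 0" unfolding \<Phi>_def by (intro integral_nonneg int nonneg) auto
  ultimately have pos: "\<Phi> 1 > 0" by simp
  have small: "\<Phi> C \<le> 4 * pi / C" if C: "1 \<le> C" for C
  proof -
    have "precession_rate a C \<theta> \<le> 2 / C" for \<theta>
    proof -
      have c: "(cos \<theta>)\<^sup>2 \<le> 1" by (simp add: abs_square_le_1)
      have "sqrt C \<le> angle_speed a C \<theta>" by (simp add: angle_speed_def)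
      then have den: "C * sqrt C \<le> (C + (cos \<theta>)\<^sup>2) * angle_speed a C \<theta>"
        using C by (intro mult_mono) auto
      have "sqrt (1 + C) \<le> sqrt (4 * C)" using C by simp
      also have "\<dots> = 2 * sqrt C" by (simp add: real_sqrt_mult)
      finally have "b * sqrt (1 + C) * (cos \<theta>)\<^sup>2 \<le> 1 * (2 * sqrt C) * 1"
        using b c C by (intro mult_mono) auto
      then have "precession_rate a C \<theta> \<le> (2 * sqrt C) / (C * sqrt C)"
        unfolding precession_rate_def b_def[symmetric] using den C b by (intro frac_le) auto
      also have "\<dots> = 2 / C" using C by simp
      finally show ?thesis .
    qed
    then have "\<Phi> C \<le> integral {0..2*pi} (\<lambda>_. 2 / C)"
      unfolding \<Phi>_def using C by (intro integral_le int) auto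
    then show ?thesis by simp
  qed
  have "continuous_on {0<..} \<Phi>"
  proof -
    have "continuous_on (Sigma {0<..} (\<lambda>_. cbox 0 (2*pi))) (\<lambda>(C, \<theta>). precession_rate a C \<theta>)"
      unfolding precession_rate_def angle_speed_def split_beta
      by (intro continuous_intros) (auto simp: add_pos_nonneg less_imp_neq[symmetric])
    from integral_continuous_on_param[OF this] show ?thesis by (simp add: \<Phi>_def[abs_def])
  qed
  obtain N :: nat where N: "2 * pi / \<Phi> 1 < real N" using reals_Archimedean2 by blast
  then have N0: "0 < N" using pos by (cases N) (auto simp: field_simps)
  have "\<exists>C. 1 \<le> C \<and> C \<le> 2 * real N \<and> \<Phi> C = 2 * pi / N"
  proof (rule IVT2')
    show "\<Phi> (2 * real N) \<le> 2 * pi / N" using small[of "2 * real N"] N0 by simp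
    show "2 * pi / N \<le> \<Phi> 1" using N pos N0 by (simp add: field_simps)
    show "continuous_on {1..2 * real N} \<Phi>"
      by (rule continuous_on_subset[OF \<open>continuous_on {0<..} \<Phi>\<close>]) auto
  qed (use N0 in auto)
  then obtain C where "1 \<le> C" "\<Phi> C = 2 * pi / N" by blast
  then show ?thesis using that[of C N] N0 by (simp add: \<Phi>_def)
qed

lemma angular_velocity_momentum:
  assumes "0 < a" "a < 1"
  shows "angular_velocity a (momentum_control a m) = vector [(1 - a\<^sup>2) * m $ 1, m $ 2, 0]"
proof -
  have "sqrt (1 - a\<^sup>2) * (sqrt (1 - a\<^sup>2) * x) = (1 - a\<^sup>2) * x" for x
    using sqrt_one_minus_square(3)[OF assms] by (metis mult.assoc power2_eq_square)
  then show ?thesis by (simp only: angular_velocity_def momentum_control_def vector_2)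
qed

text \<open>
The Euler equations of the momentum in components.
\<close>
lemma momentum_velocity:
  assumes "0 < a" "a < 1"
  shows "m \<times> angular_velocity a (momentum_control a m) =
    vector [- (m $ 2 * m $ 3), (1 - a\<^sup>2) * (m $ 1 * m $ 3), a\<^sup>2 * (m $ 1 * m $ 2)]"
  by (simp add: angular_velocity_momentum[OF assms] cross3_def vector_3 algebra_simps)

lemma momentum_at_derivative:
  assumes a: "0 < a" "a < 1" and C: "0 < C"
    and \<theta>: "(\<theta> has_real_derivative angle_speed a C (\<theta> t)) (at t)"
  defines "m \<equiv> \<lambda>t. momentum_at a C (\<theta> t)"
  shows "(m has_vector_derivative m t \<times> angular_velocity a (momentum_control a (m t))) (at t)"
proof -
  define b where "b = sqrt (1 - a\<^sup>2)"
  have b: "0 < b" "b\<^sup>2 = 1 - a\<^sup>2" using sqrt_one_minus_square[OF a] by (simp_all add: b_def)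
  let ?w = "angle_speed a C (\<theta> t)"
  have w: "0 < ?w" using C by (rule angle_speed_pos)
  have b0: "b \<noteq> 0" using b by simp
  have 1: "((\<lambda>t. sin (\<theta> t) / b) has_real_derivative ?w * cos (\<theta> t) / b) (at t)"
    by (auto intro!: derivative_eq_intros \<theta> simp: b0)
  have 2: "((\<lambda>t. cos (\<theta> t)) has_real_derivative - ?w * sin (\<theta> t)) (at t)"
    by (auto intro!: derivative_eq_intros \<theta>)
  have 3: "((\<lambda>t. - angle_speed a C (\<theta> t) / b) has_real_derivative a\<^sup>2 * cos (\<theta> t) * sin (\<theta> t) / b) (at t)"
    unfolding angle_speed_def using w b(1)
    by (auto intro!: derivative_eq_intros \<theta> simp: b0 angle_speed_def divide_simps)
  have "(m has_vector_derivative
      vector [?w * cos (\<theta> t) / b, - ?w * sin (\<theta> t), a\<^sup>2 * cos (\<theta> t) * sin (\<theta> t) / b]) (at t)"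
    unfolding m_def momentum_at_def b_def[symmetric]
    by (intro has_vector_derivative_vector3 1[unfolded has_real_derivative_iff_has_vector_derivative]
        2[unfolded has_real_derivative_iff_has_vector_derivative]
        3[unfolded has_real_derivative_iff_has_vector_derivative])
  moreover have "vector [?w * cos (\<theta> t) / b, - ?w * sin (\<theta> t), a\<^sup>2 * cos (\<theta> t) * sin (\<theta> t) / b]
      = m t \<times> angular_velocity a (momentum_control a (m t))"
    unfolding momentum_velocity[OF a] b(2)[symmetric] m_def momentum_at_def b_def[symmetric]
    using b(1) by (simp add: vector_3 power2_eq_square ac_simps)
  ultimately show ?thesis by simp
qed

text \<open>
The closed solution before normalization at time \<open>0\<close>. The rows of \<open>F\<close> are a unit vector \<open>y\<close> orthogonal
to the momentum, obtained from \<open>g = (0, m\<^sub>3, - m\<^sub>2)\<close> by \<open>rotating_vector_derivative\<close>, then its quarter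
turn about \<open>m\<close>, and the direction of \<open>m\<close>. As \<open>m\<^sub>3\<close> never vanishes, neither does \<open>g\<close>. After \<open>N\<close>
turns of \<open>\<theta>\<close> the precession angle \<open>\<phi>\<close> has grown by exactly \<open>2 \<pi>\<close>.
\<close>
lemma exists_frame_curve:
  assumes a: "0 < a" "a < 1"
  obtains F :: "real \<Rightarrow> real^3^3" and \<theta> T C where "0 < C" "0 < T"
    "\<And>t. orthogonal_matrix (F t)"
    "\<And>t. (\<theta> has_real_derivative angle_speed a C (\<theta> t)) (at t)" "surj \<theta>"
    "\<And>t. (F has_vector_derivative F t ** control_matrix a (momentum_control a (momentum_at a C (\<theta> t)))) (at t)"
    "\<And>t. F (t + T) = F t"
proof -
  obtain C N where C: "0 < C" and N: "0 < N"
    and total: "integral {0..2*pi} (precession_rate a C) = 2 * pi / real N"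
    by (rule exists_rational_precession[OF a]) blast
  define b where "b = sqrt (1 - a\<^sup>2)"
  have b: "0 < b" "b\<^sup>2 = 1 - a\<^sup>2" using sqrt_one_minus_square[OF a] by (simp_all add: b_def)
  have w: "0 < angle_speed a C x" for x using C by (rule angle_speed_pos)
  have w2: "(angle_speed a C x)\<^sup>2 = C + a\<^sup>2 * (cos x)\<^sup>2" for x
    using C by (simp add: angle_speed_def add_nonneg_nonneg)
  obtain \<theta> P where P: "0 < P" and \<theta>: "\<And>t. (\<theta> has_real_derivative angle_speed a C (\<theta> t)) (at t)"
    and \<theta>P: "\<And>t. \<theta> (t + P) = \<theta> t + 2 * pi" and surj: "surj \<theta>"
    by (rule periodic_flow[where w="angle_speed a C" and p="2 * pi", OF continuous_angle_speed w]) (auto simp: angle_speed_def)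
  have "precession_rate a C (x + 2 * pi) = precession_rate a C x" for x
    by (simp add: precession_rate_def angle_speed_def)
  moreover have "0 \<le> 2 * pi" by simp
  ultimately obtain \<Psi> where \<Psi>: "\<And>x. (\<Psi> has_real_derivative precession_rate a C x) (at x)"
    and \<Psi>_shift: "\<And>x. \<Psi> (x + 2 * pi) = \<Psi> x + integral {0..2 * pi} (precession_rate a C)"
    by (rule periodic_antiderivative[OF continuous_precession_rate[OF C]]) blast
  note \<Psi>P = \<Psi>_shift[unfolded total]
  define m where "m t = momentum_at a C (\<theta> t)" for t
  define \<omega> where "\<omega> t = angular_velocity a (momentum_control a (m t))" for t
  have m_deriv: "(m has_vector_derivative m t \<times> \<omega> t) (at t)" for t
    unfolding m_def \<omega>_def by (rule momentum_at_derivative[OF a C \<theta>])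
  have m_comp: "m t $ 1 = sin (\<theta> t) / b" "m t $ 2 = cos (\<theta> t)" "m t $ 3 = - angle_speed a C (\<theta> t) / b" for t
    by (simp_all add: m_def momentum_at_def b_def vector_3)
  define \<mu> where "\<mu> = sqrt (1 + C) / b"
  have \<mu>: "\<mu> > 0" using C b by (simp add: \<mu>_def)
  have mm: "m t \<bullet> m t = \<mu>\<^sup>2" for t
  proof -
    have "b\<^sup>2 * (m t \<bullet> m t) = (sin (\<theta> t))\<^sup>2 + b\<^sup>2 * (cos (\<theta> t))\<^sup>2 + (angle_speed a C (\<theta> t))\<^sup>2"
      using b(1) by (simp add: inner_vec_def sum_3 m_comp power2_eq_square field_simps)
    also have "\<dots> = 1 + C"
      unfolding w2 b(2) by (simp add: algebra_simps sin_squared_eq)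
    finally show ?thesis using b(1) C by (simp add: \<mu>_def power_divide field_simps)
  qed
  define \<rho>2 where "\<rho>2 t = (C + (cos (\<theta> t))\<^sup>2) / b\<^sup>2" for t
  have \<rho>2_pos: "\<rho>2 t > 0" for t using C b(1) by (simp add: \<rho>2_def add_pos_nonneg)
  have \<rho>2: "(m t $ 2)\<^sup>2 + (m t $ 3)\<^sup>2 = \<rho>2 t" for t
  proof -
    have "b\<^sup>2 * ((m t $ 2)\<^sup>2 + (m t $ 3)\<^sup>2) = b\<^sup>2 * (cos (\<theta> t))\<^sup>2 + (angle_speed a C (\<theta> t))\<^sup>2"
      using b(1) by (simp add: m_comp power_divide field_simps)
    also have "\<dots> = C + (cos (\<theta> t))\<^sup>2" unfolding w2 b(2) by (simp add: algebra_simps)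
    finally show ?thesis using b(1) by (simp add: \<rho>2_def field_simps)
  qed
  \<comment> \<open>The coefficients of \<open>g' - g \<times> \<omega>\<close> in the orthogonal basis \<open>g, m \<times> g\<close> of the plane orthogonal to \<open>m\<close>.\<close>
  define \<alpha> where "\<alpha> t = m t $ 1 * m t $ 2 * m t $ 3 / \<rho>2 t" for t
  define \<beta> where "\<beta> t = (m t $ 2)\<^sup>2 / \<rho>2 t" for t
  define g :: "real \<Rightarrow> real^3" where "g t = vector [0, m t $ 3, - (m t $ 2)]" for t
  define \<phi> where "\<phi> t = \<Psi> (\<theta> t)" for t
  define r where "r t = 1 / sqrt (\<rho>2 t)" for t
  have u: "(m t $ 2)\<^sup>2 + b\<^sup>2 * (m t $ 1)\<^sup>2 = 1" for t
    using b(1) by (simp add: m_comp power_divide)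
  have m_nth: "((\<lambda>t. m t $ i) has_real_derivative (m t \<times> \<omega> t) $ i) (at t)" for i t
    using bounded_linear.has_vector_derivative[OF bounded_linear_vec_nth m_deriv]
    by (simp add: has_real_derivative_iff_has_vector_derivative)
  have mw: "(m t \<times> \<omega> t) $ 1 = - (m t $ 2 * m t $ 3)" "(m t \<times> \<omega> t) $ 2 = b\<^sup>2 * m t $ 1 * m t $ 3"
    "(m t \<times> \<omega> t) $ 3 = a\<^sup>2 * m t $ 1 * m t $ 2" for t
    by (simp_all add: \<omega>_def momentum_velocity[OF a] b(2) vector_3)
  have g_deriv: "(g has_vector_derivative g t \<times> \<omega> t + \<alpha> t *\<^sub>R g t + \<beta> t *\<^sub>R (m t \<times> g t)) (at t)" for t
  proof -
    have "(g has_vector_derivative vector [0, (m t \<times> \<omega> t) $ 3, - ((m t \<times> \<omega> t) $ 2)]) (at t)"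
      unfolding g_def
      by (intro has_vector_derivative_vector3 has_vector_derivative_const has_vector_derivative_minus
          m_nth[unfolded has_real_derivative_iff_has_vector_derivative])
    moreover have "vector [0, (m t \<times> \<omega> t) $ 3, - ((m t \<times> \<omega> t) $ 2)]
        = g t \<times> \<omega> t + \<alpha> t *\<^sub>R g t + \<beta> t *\<^sub>R (m t \<times> g t)"
    proof -
      have \<omega>: "\<omega> t $ 1 = b\<^sup>2 * m t $ 1" "\<omega> t $ 2 = m t $ 2" "\<omega> t $ 3 = 0"
        by (simp_all add: \<omega>_def angular_velocity_momentum[OF a] vector_3 b(2))
      have 1: "\<beta> t * ((m t $ 2)\<^sup>2 + (m t $ 3)\<^sup>2) = (m t $ 2)\<^sup>2"
        unfolding \<rho>2 \<beta>_def using \<rho>2_pos[of t] by simp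
      have "\<alpha> t * m t $ 3 + \<beta> t * (m t $ 1 * m t $ 2) = m t $ 1 * m t $ 2 * ((m t $ 2)\<^sup>2 + (m t $ 3)\<^sup>2) / \<rho>2 t"
        by (simp add: \<alpha>_def \<beta>_def power2_eq_square algebra_simps flip: add_divide_distrib)
      then have 2: "\<alpha> t * m t $ 3 + \<beta> t * (m t $ 1 * m t $ 2) = m t $ 1 * m t $ 2"
        unfolding \<rho>2 using \<rho>2_pos[of t] by simp
      have 3: "\<alpha> t * m t $ 2 = \<beta> t * (m t $ 1 * m t $ 3)"
        by (simp add: \<alpha>_def \<beta>_def power2_eq_square)
      have "0 = m t $ 2 * m t $ 2 - \<beta> t * ((m t $ 2)\<^sup>2 + (m t $ 3)\<^sup>2)"
        unfolding 1 by (simp add: power2_eq_square)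
      moreover have "a\<^sup>2 * m t $ 1 * m t $ 2
          = - (m t $ 2 * (b\<^sup>2 * m t $ 1)) + (\<alpha> t * m t $ 3 + \<beta> t * (m t $ 1 * m t $ 2))"
        unfolding 2 b(2) by (simp add: algebra_simps)
      moreover have "- (b\<^sup>2 * m t $ 1 * m t $ 3)
          = - (m t $ 3 * (b\<^sup>2 * m t $ 1)) - \<alpha> t * m t $ 2 + \<beta> t * (m t $ 1 * m t $ 3)"
        unfolding 3 by simp
      ultimately show ?thesis
        by (simp add: vec_eq_iff forall_3 mw vector_3)
           (simp add: g_def cross3_def \<omega> vector_3 power2_eq_square algebra_simps)
    qed
    ultimately show ?thesis by simp
  qed
  have \<rho>2_deriv: "(\<rho>2 has_real_derivative 2 * \<alpha> t * \<rho>2 t) (at t)" for t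
  proof -
    have "((\<lambda>t. (m t $ 2)\<^sup>2 + (m t $ 3)\<^sup>2) has_real_derivative
        2 * (m t $ 2 * (m t \<times> \<omega> t) $ 2 + m t $ 3 * (m t \<times> \<omega> t) $ 3)) (at t)"
      by (auto intro!: derivative_eq_intros m_nth)
    also have "2 * (m t $ 2 * (m t \<times> \<omega> t) $ 2 + m t $ 3 * (m t \<times> \<omega> t) $ 3) = 2 * \<alpha> t * \<rho>2 t"
      using \<rho>2_pos[of t] by (simp add: mw b(2) \<alpha>_def algebra_simps)
    finally show ?thesis unfolding \<rho>2 .
  qed
  have r_deriv: "(r has_real_derivative - \<alpha> t * r t) (at t)" for t
    unfolding r_def using \<rho>2_pos[of t]
    by (auto intro!: derivative_eq_intros \<rho>2_deriv simp: field_simps)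
  have \<phi>_deriv: "(\<phi> has_real_derivative \<beta> t * \<mu>) (at t)" for t
  proof -
    have "(\<phi> has_real_derivative precession_rate a C (\<theta> t) * angle_speed a C (\<theta> t)) (at t)"
      unfolding \<phi>_def by (rule DERIV_chain2[OF \<Psi> \<theta>])
    also have "precession_rate a C (\<theta> t) * angle_speed a C (\<theta> t) = \<beta> t * \<mu>"
      unfolding precession_rate_def \<beta>_def \<mu>_def \<rho>2_def m_comp b_def[symmetric]
      using w[of "\<theta> t"] b(1) by (simp add: power2_eq_square)
    finally show ?thesis .
  qed
  have perp: "m t \<bullet> g t = 0" for t by (simp add: g_def inner_vec_def sum_3 vector_3)
  define y where "y t = (r t * cos (\<phi> t)) *\<^sub>R g t - (r t * sin (\<phi> t) / \<mu>) *\<^sub>R (m t \<times> g t)" for t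
  have y_deriv: "(y has_vector_derivative y t \<times> \<omega> t) (at t)" for t
    unfolding y_def
    by (rule rotating_vector_derivative[OF m_deriv g_deriv r_deriv \<phi>_deriv mm _ perp]) (use \<mu> in simp)
  define n where "n t = (1 / \<mu>) *\<^sub>R m t" for t
  have n_deriv: "(n has_vector_derivative n t \<times> \<omega> t) (at t)" for t
    unfolding n_def cross_mult_left
    by (rule bounded_linear.has_vector_derivative[OF bounded_linear_scaleR_right m_deriv])
  have nn: "n t \<bullet> n t = 1" for t using \<mu> by (simp add: n_def mm power2_eq_square)
  have yn: "y t \<bullet> n t = 0" for t
    using perp[of t] by (simp add: y_def n_def inner_diff_left dot_cross_self inner_commute[of "g t"])
  have yy: "y t \<bullet> y t = 1" for t
  proof -
    have gg: "g t \<bullet> g t = \<rho>2 t"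
      by (simp add: \<rho>2[symmetric] g_def inner_vec_def sum_3 vector_3 power2_eq_square)
    have mg: "(m t \<times> g t) \<bullet> (m t \<times> g t) = \<mu>\<^sup>2 * \<rho>2 t"
      using norm_cross_dot[of "m t" "g t"] by (simp add: perp mm gg power_mult_distrib power2_norm_eq_inner)
    have "y t \<bullet> y t = (r t * cos (\<phi> t))\<^sup>2 * \<rho>2 t + (r t * sin (\<phi> t) / \<mu>)\<^sup>2 * (\<mu>\<^sup>2 * \<rho>2 t)"
      by (simp add: y_def inner_diff_left inner_diff_right dot_cross_self gg mg power2_eq_square)
    also have "\<dots> = (r t)\<^sup>2 * \<rho>2 t * ((cos (\<phi> t))\<^sup>2 + (sin (\<phi> t))\<^sup>2)"
      using \<mu> by (simp add: power_mult_distrib power_divide algebra_simps del: sin_cos_squared_add sin_cos_squared_add2)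
    also have "\<dots> = 1" using \<rho>2_pos[of t] by (simp add: r_def power_divide sin_cos_squared_add2)
    finally show ?thesis .
  qed
  define F :: "real \<Rightarrow> real^3^3" where "F t = vector [y t, n t \<times> y t, n t]" for t
  have F_deriv: "(F has_vector_derivative F t ** control_matrix a (momentum_control a (momentum_at a C (\<theta> t)))) (at t)" for t
    unfolding F_def m_def[symmetric]
    by (rule frame_derivative) (use y_deriv n_deriv in \<open>simp_all add: \<omega>_def\<close>)
  have orth: "orthogonal_matrix (F t)" for t
    unfolding F_def by (rule orthogonal_matrix_cross_frame[OF yy nn yn])
  define T where "T = real N * P"
  have T: "0 < T" using N P by (simp add: T_def)
  have \<theta>T: "\<theta> (t + T) = \<theta> t + 2 * pi * real N" for t
    unfolding T_def using shift_iterate[where F=\<theta> and p=P and c="2 * pi" and n=N, OF \<theta>P] by (simp add: mult.commute)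
  have \<phi>T: "\<phi> (t + T) = \<phi> t + 2 * pi" for t
    unfolding \<phi>_def \<theta>T
    using shift_iterate[where F=\<Psi> and p="2 * pi" and c="2 * pi / real N" and n=N and x="\<theta> t", OF \<Psi>P] N
    by (simp add: mult.commute)
  have turns: "2 * pi * real N = 2 * real N * pi" by simp
  have trig: "cos (\<theta> t + 2 * pi * real N) = cos (\<theta> t)" "sin (\<theta> t + 2 * pi * real N) = sin (\<theta> t)" for t
    by (simp_all only: turns cos_add sin_add cos_2npi sin_2npi mult_1_right mult_zero_right
        diff_zero add_0_right)
  have mT: "m (t + T) = m t" for t
    by (simp add: m_def momentum_at_def angle_speed_def \<theta>T trig)
  have "\<rho>2 (t + T) = \<rho>2 t" for t by (simp add: \<rho>2_def \<theta>T trig)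
  then have "F (t + T) = F t" for t
    by (simp add: F_def y_def n_def g_def r_def mT \<phi>T)
  then show ?thesis
    by (rule that[OF C T orth \<theta> surj F_deriv])
qed

section \<open>Infinitely many periodic geodesics\<close>

text \<open>
Each starting time \<open>s\<close> on the closed solution \<open>F\<close> gives the periodic geodesic
\<open>t \<mapsto> F(s)\<^sup>T F(s + t)\<close>. Its initial control is \<open>(cos (\<theta> s), sin (\<theta> s))\<close>, so the geodesics
with \<open>\<theta> s\<close> in \<open>[0, \<pi>]\<close> are told apart by their initial velocity.
\<close>

theorem proposition3:
  fixes a :: real
  assumes "0 < a" and "a < 1"
  shows "infinite {R. geodesic a R \<and> periodic R}"
proof -
  obtain F :: "real \<Rightarrow> real^3^3" and \<theta> T C where C: "0 < C" and T: "0 < T"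
    and orth: "\<And>t. orthogonal_matrix (F t)"
    and \<theta>: "\<And>t. (\<theta> has_real_derivative angle_speed a C (\<theta> t)) (at t)" and surj: "surj \<theta>"
    and F: "\<And>t. (F has_vector_derivative F t ** control_matrix a (momentum_control a (momentum_at a C (\<theta> t)))) (at t)"
    and FT: "\<And>t. F (t + T) = F t"
    by (rule exists_frame_curve[OF assms]) blast
  define b where "b = sqrt (1 - a\<^sup>2)"
  have b: "0 < b" using sqrt_one_minus_square[OF assms] by (simp add: b_def)
  define m where "m s t = momentum_at a C (\<theta> (s + t))" for s t
  define R where "R s t = transpose (F s) ** F (s + t)" for s t
  have control: "momentum_control a (m s t) = vector [cos (\<theta> (s + t)), sin (\<theta> (s + t))]" for s t
    using b by (simp add: m_def momentum_at_def momentum_control_def b_def vector_3)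
  interpret ext: extremal a "R s" "m s" for s
  proof
    show "0 < a" "a < 1" by fact+
    show "R s 0 = mat 1" using orth[of s] by (simp add: R_def orthogonal_matrix_def)
    fix t
    have "((\<lambda>t. F (s + t)) has_vector_derivative F (s + t) ** control_matrix a (momentum_control a (m s t))) (at t)"
    proof -
      have "((\<lambda>t. s + t) has_vector_derivative 1) (at t)" by (auto intro!: derivative_eq_intros)
      from vector_diff_chain_at[OF this F] show ?thesis by (simp add: o_def m_def)
    qed
    from has_vector_derivative_matrix_matrix[OF has_vector_derivative_const this]
    show "(R s has_vector_derivative R s t ** control_matrix a (momentum_control a (m s t))) (at t)"
      unfolding R_def by (simp add: matrix_mul_assoc bounded_bilinear.zero_left[OF bounded_bilinear_matrix_matrix])
    have "((\<lambda>t. \<theta> (s + t)) has_real_derivative angle_speed a C (\<theta> (s + t))) (at t)"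
    proof -
      have "((\<lambda>t. s + t) has_real_derivative 1) (at t)" by (auto intro!: derivative_eq_intros)
      from DERIV_chain2[OF \<theta> this] show ?thesis by simp
    qed
    from momentum_at_derivative[OF assms C this]
    show "(m s has_vector_derivative m s t \<times> angular_velocity a (momentum_control a (m s t))) (at t)"
      unfolding m_def .
    show "norm (momentum_control a (m s t)) = 1"
      unfolding control by (simp add: norm_vec_def L2_set_def sum_2)
  qed
  have regular: "m s t \<times> angular_velocity a (momentum_control a (m s t)) \<noteq> 0" for s t
  proof
    assume 0: "m s t \<times> angular_velocity a (momentum_control a (m s t)) = 0"
    have m3: "m s t $ 3 \<noteq> 0"
      using b angle_speed_pos[OF C, of a "\<theta> (s + t)"] by (simp add: m_def momentum_at_def vector_3 b_def)
    have "m s t $ 2 * m s t $ 3 = 0" "b\<^sup>2 * (m s t $ 1 * m s t $ 3) = 0"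
      using arg_cong[OF 0, of "\<lambda>v. v $ 1"] arg_cong[OF 0, of "\<lambda>v. v $ 2"]
        sqrt_one_minus_square(3)[OF assms]
      unfolding momentum_velocity[OF assms] by (simp_all only: vector_3 b_def zero_index neg_equal_0_iff_equal)
    then have "m s t $ 1 = 0" "m s t $ 2 = 0" using m3 b by auto
    then show False
      using b sin_cos_squared_add[of "\<theta> (s + t)"] by (simp add: m_def momentum_at_def vector_3 b_def)
  qed
  have geo: "geodesic a (R s)" for s by (rule ext.geodesic_R[OF regular])
  have per: "periodic (R s)" for s
    using T FT[of "s + _"] by (auto simp: periodic_def R_def add.assoc[symmetric] intro!: exI[of _ T])
  obtain \<sigma> where \<sigma>: "\<And>x. \<theta> (\<sigma> x) = x" using surj by (metis surjD)
  have "inj_on (\<lambda>x. R (\<sigma> x)) {0..pi}"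
  proof (rule inj_onI)
    fix x x' assume x: "x \<in> {0..pi}" "x' \<in> {0..pi}" and eq: "R (\<sigma> x) = R (\<sigma> x')"
    have "control_matrix a (momentum_control a (m (\<sigma> x) 0)) = control_matrix a (momentum_control a (m (\<sigma> x') 0))"
      using vector_derivative_unique_at[OF ext.R_deriv[of "\<sigma> x" 0] ext.R_deriv[of "\<sigma> x'" 0, folded eq]]
      by (simp add: ext.R_zero)
    then have "control_matrix a (momentum_control a (m (\<sigma> x) 0)) $ 1 $ 3 = control_matrix a (momentum_control a (m (\<sigma> x') 0)) $ 1 $ 3"
      by simp
    then have "cos x = cos x'"
      by (simp add: control control_matrix_def X1_def X2_def A1_def A2_def vector_3 \<sigma>)
    then show "x = x'" using x by (metis arccos_cos atLeastAtMost_iff)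
  qed
  moreover have "infinite {0..pi}" by (simp add: infinite_Icc)
  ultimately have "infinite ((\<lambda>x. R (\<sigma> x)) ` {0..pi})" by (simp add: finite_image_iff)
  moreover have "(\<lambda>x. R (\<sigma> x)) ` {0..pi} \<subseteq> {R. geodesic a R \<and> periodic R}" using geo per by auto
  ultimately show ?thesis by (rule infinite_super[rotated])
qed

end
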